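(* Let $u\in\mathbb{P}^{(m)'}$ be quasi-definite, let $(P_n)_{n\ge 0}$ be its sequence of monic matrix orthogonal polynomials (MOP), and let $\gamma_n$ ($n\geq 1$) be the coefficients in the recurrence $xP_n=P_{n+1}+\beta_nP_n+\gamma_nP_{n-1}$. Then the following assertions are equivalent: (i) $u$ is a $\mathcal{P}_{2,1}$-functional. (ii) The derivatives $(P_n')_{n\ge 1}$ form a sequence of MOP with respect to some quasi-definite functional $\widetilde{u}\in\mathbb{P}^{(m)'}$. (iii) There exist matrices $a_n,b_n\in\mathbb{C}^{(m,m)}$ such that $$P_n=\frac{1}{n+1}P_{n+1}'+a_nP_n'+b_nP_{n-1}',\qquad n\ge 0,$$ with $\gamma_n-b_n$ non-singular for $n\ge 1$. Moreover, when these assertions hold, the functional $\widetilde u$ of (ii) is of the form $\widetilde{u}=u\Phi$ with $\Phi\in\mathbb{P}_2^{(m)}$, $\det\Phi\neq 0$, and $D(u\Phi)=u\Psi$ for some $\Psi\in\mathbb{P}_1^{(m)}$; besides, $\widetilde{u}$ is a quasi-definite $\mathcal{P}_{2,1}$-functional too.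
   Context: Fix $m\ge 1$. $\mathbb{C}^{(m,m)}$ is the set of $m\times m$ complex matrices and $I$ the identity matrix. $\mathbb{P}^{(m)}$ is the left $\mathbb{C}^{(m,m)}$-module of polynomials in $x$ with coefficients in $\mathbb{C}^{(m,m)}$, and $\mathbb{P}^{(m)}_n$ the subset of those of degree at most $n$. $\mathbb{P}^{(m)'}$ is the set of left-$\mathbb{C}^{(m,m)}$-linear maps $u:\mathbb{P}^{(m)}\to\mathbb{C}^{(m,m)}$, and $\langle P,u\rangle=u(P)$. For $Q(x)=\sum_k q_kx^k\in\mathbb{P}^{(m)}$, the functional $uQ$ is defined by $\langle P,uQ\rangle=\sum_k\langle x^kP,u\rangle q_k$. The derivative $Du$ is defined by $\langle P,Du\rangle=-\langle P',u\rangle$. "$\det\Phi\ne0$" means that $\det\Phi$ is not the zero polynomial. The moments of $u$ are $\mu_n=\langle x^nI,u\rangle$, $\Delta_n=(\mu_{i+j})_{i,j=0}^n$ is the block Hankel matrix, and $u$ is quasi-definite if $\det\Delta_n\ne0$ for all $n\ge0$. This is equivalent to the existence of a sequence of (left) matrix orthogonal polynomials (MOP) with respect to $u$, i.e. $(Q_n)_{n\ge0}$ with $Q_n\in\mathbb{P}^{(m)}$, $\deg Q_n=n$, non-singular leading coefficient, $\langle x^kQ_n,u\rangle=0$ for $0\le k<n$, and $\langle x^nQ_n,u\rangle$ non-singular; it is unique up to non-singular left matrix factors. In (ii), $P_{n+1}'$ plays the role of the polynomial of degree $n$. The monic MOP $(P_n)$ satisfy $xP_n=P_{n+1}+\beta_nP_n+\gamma_nP_{n-1}$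 with $\beta_n,\gamma_n\in\mathbb{C}^{(m,m)}$, $\gamma_n$ non-singular, $P_{-1}=0$. $u$ is a $\mathcal{P}_{2,1}$-functional if there exist $\Phi\in\mathbb{P}^{(m)}_2$, $\Psi\in\mathbb{P}^{(m)}_1$ with $\det\Phi\neq0$ and $D(u\Phi)=u\Psi$. *)

theory Defs
  imports "HOL-Analysis.Analysis" "Jordan_Normal_Form.Determinant"
begin

no_notation Matrix.vec_index (infixl "$" 100)
hide_const (open) Matrix.mat Determinant.det

text \<open>
  The finite index type 'm has m = CARD('m) elements; type variables range over all nonempty finite
  types, so every m \<ge> 1 is covered. Matrix polynomials are polynomials whose coefficients are matrices.
  Pitfall: on the type of matrices the class operations times and 1 are entrywise, so the ring
  structure of the polynomial type is never used below. Matrix products are always \<open>**\<close>, the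
  identity matrix is \<open>mat 1\<close>, "non-singular" is \<open>invertible\<close>.
\<close>

type_synonym 'm cmat = "complex ^ 'm ^ 'm"
type_synonym 'm mpoly = "(complex ^ 'm ^ 'm) poly"
type_synonym 'm mfunctional = "(complex ^ 'm ^ 'm) poly \<Rightarrow> complex ^ 'm ^ 'm"

definition lsmult :: "'m::finite cmat \<Rightarrow> 'm mpoly \<Rightarrow> 'm mpoly" (infixr "*\<^sub>l" 75) where
  "A *\<^sub>l P = map_poly (\<lambda>C. A ** C) P"

definition xpow_mult :: "nat \<Rightarrow> 'm::finite mpoly \<Rightarrow> 'm mpoly" where
  "xpow_mult k P = (pCons 0 ^^ k) P"

definition mderiv :: "'m::finite mpoly \<Rightarrow> 'm mpoly" where
  "mderiv P = (\<Sum>k = 1..degree P. monom (real k *\<^sub>R coeff P k) (k - 1))"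

text \<open>The determinant of a matrix polynomial, read as a matrix with polynomial entries.\<close>
definition mpoly_det :: "'m::finite mpoly \<Rightarrow> complex poly" where
  "mpoly_det P = Determinants.det (\<chi> i j. map_poly (\<lambda>A. A $ i $ j) P)"

definition left_linear :: "'m::finite mfunctional \<Rightarrow> bool" where
  "left_linear u \<longleftrightarrow>
     (\<forall>P Q. u (P + Q) = u P + u Q) \<and> (\<forall>A P. u (A *\<^sub>l P) = A ** u P)"

definition fun_mult :: "'m::finite mfunctional \<Rightarrow> 'm mpoly \<Rightarrow> 'm mfunctional" where
  "fun_mult u Q = (\<lambda>P. \<Sum>k\<le>degree Q. u (xpow_mult k P) ** coeff Q k)"

definition fun_deriv :: "'m::finite mfunctional \<Rightarrow> 'm mfunctional" where
  "fun_deriv u = (\<lambda>P. - u (mderiv P))"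

definition moment :: "'m::finite mfunctional \<Rightarrow> nat \<Rightarrow> 'm cmat" where
  "moment u n = u (monom (mat 1) n)"

text \<open>
  The block Hankel matrix as a square matrix of size (n+1)m: the entry (r, c) lies in block
  (r div m, c div m), at position (r mod m, c mod m) of that block. \<open>from_nat_into UNIV\<close> enumerates
  the index type by 0, ..., m-1; another enumeration permutes rows and columns alike and
  leaves the determinant unchanged.
\<close>
definition block_hankel :: "'m::finite mfunctional \<Rightarrow> nat \<Rightarrow> complex Matrix.mat" where
  "block_hankel u n =
     (let m = CARD('m); \<iota> = from_nat_into (UNIV :: 'm set)
      in Matrix.mat ((n + 1) * m) ((n + 1) * m)
           (\<lambda>(r, c). moment u (r div m + c div m) $ \<iota> (r mod m) $ \<iota> (c mod m)))"

definition quasi_definite :: "'m::finite mfunctional \<Rightarrow> bool" where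
  "quasi_definite u \<longleftrightarrow> (\<forall>n. Determinant.det (block_hankel u n) \<noteq> 0)"

definition is_MOP :: "'m::finite mfunctional \<Rightarrow> (nat \<Rightarrow> 'm mpoly) \<Rightarrow> bool" where
  "is_MOP u Q \<longleftrightarrow>
     (\<forall>n. degree (Q n) = n \<and> invertible (lead_coeff (Q n)) \<and>
          (\<forall>k<n. u (xpow_mult k (Q n)) = 0) \<and> invertible (u (xpow_mult n (Q n))))"

definition monic_mpoly :: "'m::finite mpoly \<Rightarrow> bool" where
  "monic_mpoly P \<longleftrightarrow> lead_coeff P = mat 1"

text \<open>The term of index n - 1 of a sequence, with the convention that the term of index -1 is 0.\<close>
definition pred_term :: "(nat \<Rightarrow> 'm::finite mpoly) \<Rightarrow> nat \<Rightarrow> 'm mpoly" where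
  "pred_term P n = (if n = 0 then 0 else P (n - 1))"

text \<open>The equation D(u\<Phi>) = u\<Psi> with its side conditions.\<close>
definition pearson_pair :: "'m::finite mfunctional \<Rightarrow> 'm mpoly \<Rightarrow> 'm mpoly \<Rightarrow> bool" where
  "pearson_pair u \<Phi> \<Psi> \<longleftrightarrow>
     degree \<Phi> \<le> 2 \<and> degree \<Psi> \<le> 1 \<and> mpoly_det \<Phi> \<noteq> 0 \<and>
     fun_deriv (fun_mult u \<Phi>) = fun_mult u \<Psi>"

definition P21_functional :: "'m::finite mfunctional \<Rightarrow> bool" where
  "P21_functional u \<longleftrightarrow> (\<exists>\<Phi> \<Psi>. pearson_pair u \<Phi> \<Psi>)"

end

theory Submission
  imports Defs
begin

text \<open>
  Write \<open>\<langle>P, Q\<rangle>\<close> for \<open>\<langle>P, uQ\<rangle>\<close>. The functional u is quasi-definite iff no nonzero Q of degree at most n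
  is right orthogonal to \<open>1, x, ..., x\<^sup>n\<close>, and iff the same holds on the left. If \<open>D(u\<Phi>) = u\<Psi>\<close> then
  \<open>\<langle>P', \<Phi>G\<rangle> = - \<langle>P, \<Psi>G + \<Phi>G'\<rangle>\<close>. So if G of degree at most n is right orthogonal for \<open>u\<Phi>\<close> up to \<open>x\<^sup>n\<close>,
  then \<open>\<Psi>G + \<Phi>G'\<close>, of degree at most n + 1, is so for u up to \<open>x\<^sup>n\<^sup>+\<^sup>1\<close>; hence it vanishes, hence \<open>\<Phi>G = 0\<close>,
  and G = 0 because \<open>det \<Phi> \<noteq> 0\<close>. Thus \<open>u\<Phi>\<close> is quasi-definite, which forces all \<open>\<psi>\<^sub>1 + n\<phi>\<^sub>2\<close> to be
  non-singular; these matrices control both the norms of the derivatives and \<open>\<gamma>\<^sub>n - b\<^sub>n\<close>.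
  Conversely, the relation in (iii) turns the recurrence of \<open>P\<^sub>n\<close> into one for the derivatives, to
  which Favard's theorem applies. Both the recurrence and the relation survive differentiation,
  and \<open>\<gamma>\<^sub>n - 2b\<^sub>n\<close> is non-singular too, so the argument can be repeated for \<open>u\<Phi>\<close>.
\<close>

subsection \<open>Matrices and matrix polynomials\<close>

text \<open>The class product of matrices is entrywise, so the ring rules do not apply to
  \<open>**\<close>. Its distributivity and its compatibility with real scalars and finite sums come
  from this bilinearity.\<close>

lemma bounded_bilinear_matrix_matrix_mult:
  "bounded_bilinear ((**) :: complex^'n::finite^'m::finite \<Rightarrow> complex^'p::finite^'n \<Rightarrow> complex^'p^'m)"
  unfolding bilinear_conv_bounded_bilinear[symmetric] bilinear_def
  by (auto intro!: linearI simp: matrix_matrix_mult_def Finite_Cartesian_Product.vec_eq_iff sum.distrib algebra_simps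
      scaleR_sum_right)

interpretation matmul: bounded_bilinear
  "(**) :: complex^'n::finite^'m::finite \<Rightarrow> complex^'p::finite^'n \<Rightarrow> complex^'p^'m"
  by (rule bounded_bilinear_matrix_matrix_mult)

text \<open>Scalar factors of polynomials occur only as matrices acting through
  \<open>*\<^sub>l\<close>. On coefficients these rules turn them into real scalars.\<close>

lemma mat_of_real_mult [simp]: "Finite_Cartesian_Product.mat (of_real r) ** A = r *\<^sub>R (A :: 'm::finite cmat)"
proof -
  have "Finite_Cartesian_Product.mat (of_real r) = r *\<^sub>R (Finite_Cartesian_Product.mat 1 :: 'm cmat)"
    by (simp add: Finite_Cartesian_Product.mat_def Finite_Cartesian_Product.vec_eq_iff of_real_def)
  then show ?thesis by (simp add: matmul.scaleR_left)
qed

lemma mat_of_nat_mult [simp]: "Finite_Cartesian_Product.mat (of_nat k) ** A = real k *\<^sub>R (A :: 'm::finite cmat)"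
  using mat_of_real_mult[of "real k" A] by simp

lemma mat_inverse_of_nat_mult [simp]:
  "Finite_Cartesian_Product.mat (1 / of_nat k) ** A = (1 / real k) *\<^sub>R (A :: 'm::finite cmat)"
  using mat_of_real_mult[of "1 / real k" A] by simp

lemma invertible_cancel_left:
  fixes A B :: "'m::finite cmat"
  assumes "invertible (A ** B)" shows "invertible A"
  using assms unfolding invertible_right_inverse by (metis matrix_mul_assoc)

lemma invertible_cancel_right:
  fixes A B :: "'m::finite cmat"
  assumes "invertible (A ** B)" shows "invertible B"
  using assms unfolding invertible_left_inverse by (metis matrix_mul_assoc)

lemma invertible_imp_nonzero:
  fixes A :: "'m::finite cmat"
  assumes "invertible A" shows "A \<noteq> 0"
proof
  assume "A = 0"
  then have "(Finite_Cartesian_Product.mat 1 :: 'm cmat) = 0"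
    using assms unfolding invertible_right_inverse by simp
  then have "(Finite_Cartesian_Product.mat 1 :: 'm cmat) $ i $ i = 0" for i by simp
  then show False by (simp add: Finite_Cartesian_Product.mat_def)
qed

lemma invertible_minus:
  fixes A :: "'m::finite cmat"
  assumes "invertible A" shows "invertible (- A)"
  using scalar_invertible[of "-1" A] assms by simp

lemma invertible_mult_eq_0_right:
  fixes A B :: "'m::finite cmat"
  assumes "A ** B = 0" "invertible B" shows "A = 0"
  using assms unfolding invertible_right_inverse
  by (metis matrix_mul_assoc matrix_mul_rid matmul.zero_left)

text \<open>A vector in the kernel of the transpose, repeated in every row of a matrix B, gives B **
  A = 0. So a trivial left kernel among matrices makes the transpose injective.\<close>

lemma not_invertible_left_kernel:
  fixes A :: "'m::finite cmat"
  assumes "\<And>B :: 'm cmat. B ** A = 0 \<Longrightarrow> B = 0"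
  shows "invertible A"
proof -
  have "x = 0" if x: "transpose A *v x = 0" for x
  proof -
    define B :: "'m cmat" where "B = (\<chi> i j. x $ j)"
    have "B ** A = 0"
      using x by (simp add: B_def Finite_Cartesian_Product.vec_eq_iff matrix_matrix_mult_def matrix_vector_mult_def
          transpose_def mult.commute)
    then have "B = 0" by (rule assms)
    then show ?thesis by (simp add: B_def Finite_Cartesian_Product.vec_eq_iff)
  qed
  then have "invertible (Finite_Cartesian_Product.transpose A)"
    by (simp add: invertible_left_inverse matrix_left_invertible_ker)
  then have "\<exists>C. transpose A ** C = Finite_Cartesian_Product.mat 1"
    unfolding invertible_right_inverse .
  then show ?thesis
    unfolding invertible_left_inverse right_invertible_transpose .
qed

lemma degree_eqI:
  assumes "coeff P n \<noteq> 0" "\<And>k. k > n \<Longrightarrow> coeff P k = 0"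
  shows "degree P = n"
  using assms by (intro antisym degree_le le_degree) auto

lemma coeff_lsmult [simp]: "coeff (A *\<^sub>l P) n = A ** coeff P n"
  by (simp add: lsmult_def coeff_map_poly)

lemma xpow_mult_0 [simp]: "xpow_mult 0 P = P"
  and xpow_mult_Suc [simp]: "xpow_mult (Suc k) P = pCons 0 (xpow_mult k P)"
  by (simp_all add: xpow_mult_def)

lemma coeff_xpow_mult [simp]: "coeff (xpow_mult k P) n = (if n < k then 0 else coeff P (n - k))"
  by (induction k arbitrary: n) (auto simp: coeff_pCons split: nat.splits)

lemma xpow_mult_pCons_0: "xpow_mult k (pCons 0 P) = pCons 0 (xpow_mult k P)"
  by (simp add: xpow_mult_def funpow_swap1)

lemma xpow_mult_add [simp]: "xpow_mult k (P + Q) = xpow_mult k P + xpow_mult k Q"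
  by (rule poly_eqI) simp

lemma xpow_mult_diff [simp]: "xpow_mult k (P - Q) = xpow_mult k P - xpow_mult k Q"
  by (rule poly_eqI) simp

lemma xpow_mult_lsmult [simp]: "xpow_mult k (A *\<^sub>l P) = A *\<^sub>l xpow_mult k P"
  by (rule poly_eqI) simp

lemma xpow_mult_zero [simp]: "xpow_mult k 0 = 0"
  by (rule poly_eqI) simp

lemma xpow_mult_monom: "xpow_mult k (monom A n) = monom A (k + n)"
  by (rule poly_eqI) auto

lemma pCons_0_lsmult: "pCons 0 (A *\<^sub>l P) = A *\<^sub>l pCons 0 P"
  by (rule poly_eqI) (auto simp: coeff_pCons split: nat.splits)

lemma lsmult_zero [simp]: "A *\<^sub>l 0 = 0"
  by (rule poly_eqI) simp

lemma coeff_mderiv [simp]: "coeff (mderiv P) n = real (Suc n) *\<^sub>R coeff P (Suc n)"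
proof -
  have "coeff (mderiv P) n = (\<Sum>k = 1..degree P. if k = Suc n then real k *\<^sub>R coeff P k else 0)"
    unfolding mderiv_def coeff_sum by (rule sum.cong) auto
  also have "\<dots> = (if Suc n \<le> degree P then real (Suc n) *\<^sub>R coeff P (Suc n) else 0)"
    by (subst sum.delta) auto
  finally show ?thesis by (auto simp: coeff_eq_0)
qed

lemma mderiv_0 [simp]: "mderiv 0 = 0"
  and mderiv_add: "mderiv (P + Q) = mderiv P + mderiv Q"
  and mderiv_lsmult: "mderiv (A *\<^sub>l P) = A *\<^sub>l mderiv P"
  by (rule poly_eqI; simp add: scaleR_add_right matmul.scaleR_right del: of_nat_Suc)+

lemma mderiv_pCons_0: "mderiv (pCons 0 P) = P + pCons 0 (mderiv P)"
  by (rule poly_eqI) (auto simp: coeff_pCons algebra_simps split: nat.splits)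

text \<open>Leibniz rule. For k = 0 the truncated exponent k - 1 does no harm, because its factor is
  the zero matrix.\<close>

lemma mderiv_xpow_mult:
  "mderiv (xpow_mult k P) = Finite_Cartesian_Product.mat (of_nat k) *\<^sub>l xpow_mult (k - 1) P + xpow_mult k (mderiv P)"
proof (cases k)
  case (Suc j)
  show ?thesis
  proof (rule poly_eqI)
    fix n
    consider "n < j" | "n = j" | "n > j" by linarith
    then show "coeff (mderiv (xpow_mult k P)) n =
        coeff (Finite_Cartesian_Product.mat (of_nat k) *\<^sub>l xpow_mult (k - 1) P + xpow_mult k (mderiv P)) n"
    proof cases
      case 3
      then obtain d where n: "n = Suc (j + d)" using less_imp_Suc_add by blast
      have "real (Suc (Suc (j + d))) = real (Suc j) + real (Suc d)" by simp
      then have "real (Suc (Suc (j + d))) *\<^sub>R C = real (Suc j) *\<^sub>R C + real (Suc d) *\<^sub>R C" for C :: "'a cmat"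
        by (simp only: scaleR_add_left)
      then show ?thesis by (simp add: Suc n del: of_nat_Suc xpow_mult_Suc)
    qed (simp_all add: Suc del: of_nat_Suc xpow_mult_Suc)
  qed
qed (simp add: poly_eq_iff)

subsection \<open>Left linear functionals\<close>

lemma left_linear_add: "left_linear u \<Longrightarrow> u (P + Q) = u P + u Q"
  and left_linear_lsmult: "left_linear u \<Longrightarrow> u (A *\<^sub>l P) = A ** u P"
  by (simp_all add: left_linear_def)

lemma left_linear_additive: "left_linear u \<Longrightarrow> Modules.additive u"
  by (simp add: left_linear_def Modules.additive_def)

lemmas left_linear_zero = Modules.additive.zero[OF left_linear_additive]
  and left_linear_diff = Modules.additive.diff[OF left_linear_additive]
  and left_linear_sum = Modules.additive.sum[OF left_linear_additive]

text \<open>The degree bound is expressed by vanishing coefficients from index n on. Unlike a bound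
  on \<open>degree\<close>, this includes n = 0 for the zero polynomial, where the inductions on n
  begin.\<close>

lemma left_linear_moments:
  assumes "left_linear u" and "\<And>k. k \<ge> n \<Longrightarrow> coeff P k = 0"
  shows "u P = (\<Sum>k<n. coeff P k ** moment u k)"
proof -
  have monom: "monom A k = A *\<^sub>l monom (Finite_Cartesian_Product.mat 1) k" for A :: "'a cmat" and k
    by (rule poly_eqI) auto
  have "P = (\<Sum>k<n. monom (coeff P k) k)"
    by (rule poly_eqI) (use assms(2) in \<open>auto simp: coeff_sum sum.delta\<close>)
  then have "u P = (\<Sum>k<n. u (monom (coeff P k) k))"
    using left_linear_sum[OF assms(1)] by metis
  also have "\<dots> = (\<Sum>k<n. coeff P k ** moment u k)"
    by (subst monom) (simp add: left_linear_lsmult[OF assms(1)] moment_def)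
  finally show ?thesis .
qed

lemma fun_mult_eq_sum_lessThan:
  assumes "\<And>k. k \<ge> n \<Longrightarrow> coeff Q k = 0"
  shows "fun_mult u Q P = (\<Sum>k<n. u (xpow_mult k P) ** coeff Q k)"
  unfolding fun_mult_def by (rule sum.mono_neutral_cong) (auto simp: assms coeff_eq_0 not_less)

lemma fun_mult_eq_sum:
  assumes "degree Q \<le> n"
  shows "fun_mult u Q P = (\<Sum>k\<le>n. u (xpow_mult k P) ** coeff Q k)"
  using fun_mult_eq_sum_lessThan[of "Suc n" Q u P] assms by (simp add: coeff_eq_0 lessThan_Suc_atMost)

lemma fun_mult_0 [simp]: "fun_mult u 0 P = 0"
  by (simp add: fun_mult_def)

text \<open>Horner form of the right action of polynomials on functionals, which makes induction on
  Q possible.\<close>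

lemma fun_mult_pCons: "fun_mult u (pCons a Q) P = u P ** a + fun_mult u Q (pCons 0 P)"
proof -
  have "fun_mult u (pCons a Q) P = (\<Sum>k\<le>Suc (degree Q). u (xpow_mult k P) ** coeff (pCons a Q) k)"
    by (rule fun_mult_eq_sum) (rule degree_pCons_le)
  also have "\<dots> = u P ** a + (\<Sum>k\<le>degree Q. u (xpow_mult k (pCons 0 P)) ** coeff Q k)"
    by (simp only: sum.atMost_Suc_shift) (simp add: xpow_mult_pCons_0)
  finally show ?thesis by (simp add: fun_mult_def)
qed

lemma fun_mult_add: "fun_mult u (Q + R) P = fun_mult u Q P + fun_mult u R P"
proof -
  let ?n = "max (degree Q) (degree R)"
  have "degree (Q + R) \<le> ?n" by (rule degree_add_le_max)
  then show ?thesis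
    by (simp add: fun_mult_eq_sum[of _ ?n] matmul.add_right sum.distrib)
qed

lemma fun_mult_monom: "fun_mult u (monom A k) P = u (xpow_mult k P) ** A"
  by (subst fun_mult_eq_sum[OF degree_monom_le])
    (simp add: sum.delta if_distrib[of "(**) _"] cong: if_cong)

lemma left_linear_fun_mult:
  assumes "left_linear u" shows "left_linear (fun_mult u Q)"
  using assms unfolding left_linear_def fun_mult_def
  by (simp add: matmul.add_left sum.distrib matmul.sum_right matrix_mul_assoc)

lemma left_linear_fun_deriv:
  assumes "left_linear u" shows "left_linear (fun_deriv u)"
  using assms unfolding left_linear_def fun_deriv_def
  by (simp add: mderiv_add mderiv_lsmult matmul.minus_right)

lemma left_linear_diff_functional:
  assumes "left_linear u" "left_linear v" shows "left_linear (\<lambda>P. u P - v P)"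
  using assms unfolding left_linear_def by (simp add: matmul.diff_right)

subsection \<open>Products of matrix polynomials\<close>

definition rsmult :: "'m::finite mpoly \<Rightarrow> 'm cmat \<Rightarrow> 'm mpoly" where
  "rsmult P A = map_poly (\<lambda>C. C ** A) P"

text \<open>The product with \<open>**\<close> on coefficients, by the Horner recursion P(A + xQ) =
  PA + x(PQ). Recursing on the right factor matches \<open>fun_mult_pCons\<close>.\<close>

definition mpmult :: "'m::finite mpoly \<Rightarrow> 'm mpoly \<Rightarrow> 'm mpoly" where
  "mpmult P Q = fold_coeffs (\<lambda>A R. rsmult P A + pCons 0 R) Q 0"

lemma coeff_rsmult [simp]: "coeff (rsmult P A) n = coeff P n ** A"
  by (simp add: rsmult_def coeff_map_poly)

lemma mpmult_0_right [simp]: "mpmult P 0 = 0"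
  by (simp add: mpmult_def)

lemma mpmult_pCons: "mpmult P (pCons A Q) = rsmult P A + pCons 0 (mpmult P Q)"
proof (cases "A = 0 \<and> Q = 0")
  case True
  moreover have "rsmult P 0 = 0" by (rule poly_eqI) simp
  ultimately show ?thesis by simp
next
  case False
  then show ?thesis by (cases "A = 0") (auto simp: mpmult_def)
qed

lemma coeff_mpmult: "coeff (mpmult P Q) n = (\<Sum>i\<le>n. coeff P i ** coeff Q (n - i))"
proof (induction Q arbitrary: n)
  case 0
  then show ?case by simp
next
  case (pCons A Q)
  show ?case
  proof (cases n)
    case 0
    then show ?thesis by (simp add: mpmult_pCons)
  next
    case (Suc m)
    then show ?thesis by (simp add: mpmult_pCons pCons.IH Suc_diff_le add.commute)
  qed
qed

lemma coeff_mpmult_eq_0: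
  assumes "degree P \<le> m" "\<And>k. k \<ge> n \<Longrightarrow> coeff Q k = 0" "k \<ge> m + n"
  shows "coeff (mpmult P Q) k = 0"
  unfolding coeff_mpmult
proof (intro sum.neutral ballI)
  fix i assume "i \<in> {..k}"
  then show "coeff P i ** coeff Q (k - i) = 0"
    using assms by (cases "i \<le> m") (auto simp: coeff_eq_0)
qed

lemma fun_mult_rsmult: "fun_mult u (rsmult Q A) P = fun_mult u Q P ** A"
proof -
  have "degree (rsmult Q A) \<le> degree Q"
    by (rule degree_le) (simp add: coeff_eq_0)
  then show ?thesis
    by (simp add: fun_mult_eq_sum[of _ "degree Q"] matmul.sum_left matrix_mul_assoc)
qed

text \<open>Functionals form a right module: u(QR) = (uQ)R. Both sides obey the same Horner
  recursion in R.\<close>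

lemma fun_mult_mpmult: "fun_mult u (mpmult Q R) P = fun_mult (fun_mult u Q) R P"
  by (induction R arbitrary: P)
    (simp_all add: mpmult_pCons fun_mult_add fun_mult_pCons fun_mult_rsmult)

subsection \<open>The determinant of a matrix polynomial\<close>

text \<open>Both determinants are Leibniz sums; an enumeration f of the index type carries
  permutations to permutations and keeps their signs.\<close>

lemma det_eq_det_mat:
  fixes A :: "'a::comm_ring_1^'m::finite^'m"
  assumes f: "bij_betw f {0..<CARD('m)} (UNIV :: 'm set)"
  shows "Determinants.det A = Determinant.det (Matrix.mat CARD('m) CARD('m) (\<lambda>(i, j). A $ f i $ f j))"
proof -
  let ?N = "{0..<CARD('m)}"
  let ?g = "\<lambda>\<pi> x. if x \<in> UNIV then f (\<pi> (inv_into ?N f x)) else x"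
  have "Determinants.det A = (\<Sum>\<pi> | \<pi> permutes (UNIV :: 'm set). of_int (sign \<pi>) * (\<Prod>i\<in>UNIV. A $ i $ \<pi> i))"
    by (simp add: Determinants.det_def)
  also have "\<dots> = (\<Sum>\<pi> | \<pi> permutes ?N. of_int (sign (?g \<pi>)) * (\<Prod>i\<in>UNIV. A $ i $ ?g \<pi> i))"
    by (rule sum.reindex_bij_betw[OF bij_betw_permutations[OF f], symmetric])
  also have "\<dots> = (\<Sum>\<pi> | \<pi> permutes ?N. of_int (sign \<pi>) * (\<Prod>i\<in>?N. A $ f i $ f (\<pi> i)))"
  proof (rule sum.cong[OF refl])
    fix \<pi> assume "\<pi> \<in> {\<pi>. \<pi> permutes ?N}"
    then have \<pi>: "\<pi> permutes ?N" by simp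
    interpret permutes_bij_finite \<pi> ?N UNIV f "inv_into ?N f" "?g \<pi>"
      using f \<pi> by unfold_locales (auto simp: bij_betw_def)
    have "(\<Prod>i\<in>UNIV. A $ i $ ?g \<pi> i) = (\<Prod>i\<in>?N. A $ f i $ ?g \<pi> (f i))"
      by (rule prod.reindex_bij_betw[OF f, symmetric])
    also have "\<dots> = (\<Prod>i\<in>?N. A $ f i $ f (\<pi> i))"
      by (rule prod.cong) (auto simp: f'_f)
    finally show "of_int (sign (?g \<pi>)) * (\<Prod>i\<in>UNIV. A $ i $ ?g \<pi> i) =
        of_int (sign \<pi>) * (\<Prod>i\<in>?N. A $ f i $ f (\<pi> i))"
      using sign_p' by simp
  qed
  also have "\<dots> = Determinant.det (Matrix.mat CARD('m) CARD('m) (\<lambda>(i, j). A $ f i $ f j))"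
    by (subst det_def'[of _ "CARD('m)"]) (auto intro!: sum.cong prod.cong simp: permutes_in_image
        dest: permutes_in_image)
  finally show ?thesis .
qed

text \<open>The generality of an integral domain serves matrices with polynomial entries, for which
  the kernel vector is again sought among polynomials.\<close>

lemma det_eq_0_iff_kernel:
  fixes A :: "'a::idom^'m::finite^'m"
  shows "Determinants.det A = 0 \<longleftrightarrow> (\<exists>x. x \<noteq> 0 \<and> A *v x = 0)"
proof -
  define n where "n = CARD('m)"
  define f where "f = from_nat_into (UNIV :: 'm set)"
  have f: "bij_betw f {0..<n} UNIV"
    unfolding f_def n_def by (metis bij_betw_from_nat_into_finite finite lessThan_atLeast0)
  define g where "g = inv_into {0..<n} f"
  have gf: "g (f i) = i" if "i < n" for i
    using f that by (simp add: g_def bij_betw_def)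
  have fg: "f (g x) = x" "g x < n" for x
    using f bij_betw_inv_into_right[OF f] bij_betw_inv_into[OF f]
    by (auto simp: g_def bij_betw_def)
  let ?M = "Matrix.mat n n (\<lambda>(i, j). A $ f i $ f j)"
  have mult: "vec_index (?M *\<^sub>v v) i = (A *v (\<chi> j. vec_index v (g j))) $ f i"
    if "v \<in> carrier_vec n" "i < n" for v i
    using that sum.reindex_bij_betw[OF f, of "\<lambda>j. A $ f i $ j * vec_index v (g j)"]
    by (simp add: matrix_vector_mult_def scalar_prod_def gf)
  have "Determinants.det A = 0 \<longleftrightarrow> (\<exists>v. v \<in> carrier_vec n \<and> v \<noteq> 0\<^sub>v n \<and> ?M *\<^sub>v v = 0\<^sub>v n)"
    using det_eq_det_mat[OF f[unfolded n_def], of A] det_0_iff_vec_prod_zero[of ?M n]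
    by (simp add: n_def)
  also have "\<dots> \<longleftrightarrow> (\<exists>x. x \<noteq> 0 \<and> A *v x = 0)"
  proof safe
    fix v assume v: "v \<in> carrier_vec n" "v \<noteq> 0\<^sub>v n" "?M *\<^sub>v v = 0\<^sub>v n"
    define x where "x = (\<chi> j. vec_index v (g j))"
    have "(A *v x) $ i = 0" for i
      using mult[OF v(1) fg(2)[of i]] v(3) by (simp add: x_def fg)
    then have "A *v x = 0" by (simp add: Finite_Cartesian_Product.vec_eq_iff)
    moreover have "x \<noteq> 0"
    proof
      assume "x = 0"
      then have "vec_index v (g j) = 0" for j by (simp add: x_def Finite_Cartesian_Product.vec_eq_iff)
      from this[of "f _"] have "vec_index v i = 0" if "i < n" for i using gf that by metis
      then have "v = 0\<^sub>v n" using v(1) by (intro eq_vecI) auto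
      then show False using v(2) by simp
    qed
    ultimately show "\<exists>x. x \<noteq> 0 \<and> A *v x = 0" by blast
  next
    fix x :: "'a^'m" assume x: "x \<noteq> 0" "A *v x = 0"
    define v where "v = Matrix.vec n (\<lambda>i. x $ f i)"
    have v: "v \<in> carrier_vec n" by (simp add: v_def)
    have x_eq: "(\<chi> j. vec_index v (g j)) = x" by (simp add: v_def fg Finite_Cartesian_Product.vec_eq_iff)
    have "?M *\<^sub>v v = 0\<^sub>v n"
      using mult[OF v] by (intro eq_vecI) (auto simp: x_eq x)
    moreover have "v \<noteq> 0\<^sub>v n"
    proof
      assume "v = 0\<^sub>v n"
      then have "(\<chi> j. vec_index v (g j)) = 0" by (simp add: Finite_Cartesian_Product.vec_eq_iff fg)
      then show False using x x_eq by simp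
    qed
    ultimately show "\<exists>v. v \<in> carrier_vec n \<and> v \<noteq> 0\<^sub>v n \<and> ?M *\<^sub>v v = 0\<^sub>v n"
      using v by blast
  qed
  finally show ?thesis .
qed

text \<open>If PQ = 0, every column of Q lies in the kernel of P, read as a matrix over the
  polynomials. Conversely a kernel vector x, repeated in every column, gives a matrix polynomial Q
  with PQ = 0.\<close>

lemma mpoly_det_nonzero_iff: "mpoly_det P \<noteq> 0 \<longleftrightarrow> (\<forall>Q. mpmult P Q = 0 \<longrightarrow> Q = 0)"
  for P :: "'m::finite mpoly"
proof -
  let ?P = "\<chi> i j. map_poly (\<lambda>A. A $ i $ j) P"
  let ?col = "\<lambda>Q l. \<chi> i. map_poly (\<lambda>A :: 'm cmat. A $ i $ l) Q"
  have coeff_col: "coeff (?col Q l $ i) n = coeff Q n $ i $ l" for Q l i n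
    by (simp add: coeff_map_poly)
  have mult: "?P *v ?col Q l = ?col (mpmult P Q) l" for Q l
  proof (subst Finite_Cartesian_Product.vec_eq_iff, intro allI poly_eqI)
    fix i n
    have "coeff ((?P *v ?col Q l) $ i) n =
        (\<Sum>j\<in>UNIV. \<Sum>k\<le>n. coeff P k $ i $ j * coeff Q (n - k) $ j $ l)"
      by (simp add: matrix_vector_mult_def coeff_sum coeff_mult coeff_map_poly)
    also have "\<dots> = coeff (mpmult P Q) n $ i $ l"
      by (subst sum.swap) (simp add: coeff_mpmult matrix_matrix_mult_def)
    finally show "coeff ((?P *v ?col Q l) $ i) n = coeff (?col (mpmult P Q) l $ i) n"
      by (simp add: coeff_map_poly)
  qed
  show ?thesis
  proof
    assume det: "mpoly_det P \<noteq> 0"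
    show "\<forall>Q. mpmult P Q = 0 \<longrightarrow> Q = 0"
    proof (intro allI impI)
      fix Q assume Q: "mpmult P Q = 0"
      have "?col Q l = 0" for l
      proof -
        have "?P *v ?col Q l = 0" unfolding mult Q by (simp add: Finite_Cartesian_Product.vec_eq_iff)
        then show ?thesis using det unfolding mpoly_det_def det_eq_0_iff_kernel by blast
      qed
      then have "coeff Q n $ i $ l = 0" for n i l
        using coeff_col[where Q = Q and l = l and i = i and n = n] by simp
      then show "Q = 0" by (intro poly_eqI) (simp add: Finite_Cartesian_Product.vec_eq_iff)
    qed
  next
    assume inj: "\<forall>Q. mpmult P Q = 0 \<longrightarrow> Q = 0"
    show "mpoly_det P \<noteq> 0"
    proof
      assume "mpoly_det P = 0"
      then obtain x where x: "x \<noteq> 0" "?P *v x = 0"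
        unfolding mpoly_det_def det_eq_0_iff_kernel by blast
      define Q :: "'m mpoly" where
        "Q = (\<Sum>j\<in>UNIV. map_poly (\<lambda>c. \<chi> i l. if i = j then c else 0) (x $ j))"
      have coeff_Q: "coeff Q n $ i $ l = coeff (x $ i) n" for n i l
        unfolding Q_def coeff_sum sum_component
        by (subst coeff_map_poly) (simp_all add: Finite_Cartesian_Product.vec_eq_iff sum.delta)
      have "?col Q l = x" for l
        by (simp add: Finite_Cartesian_Product.vec_eq_iff poly_eq_iff coeff_map_poly coeff_Q)
      then have "?col (mpmult P Q) l = 0" for l
        using mult[where Q = Q and l = l] x by simp
      then have "coeff (mpmult P Q) n $ i $ l = 0" for n i l
        using coeff_col[where Q = "mpmult P Q" and l = l and i = i and n = n] by simp
      then have "mpmult P Q = 0" by (intro poly_eqI) (simp add: Finite_Cartesian_Product.vec_eq_iff)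
      then have "Q = 0" using inj by blast
      then have "x = 0" using coeff_Q by (simp add: Finite_Cartesian_Product.vec_eq_iff poly_eq_iff)
      then show False using x by simp
    qed
  qed
qed

subsection \<open>Quasi-definiteness as injectivity\<close>

definition block_mat :: "nat \<Rightarrow> (nat \<Rightarrow> nat \<Rightarrow> 'm::finite cmat) \<Rightarrow> complex Matrix.mat" where
  "block_mat n M = Matrix.mat (n * CARD('m)) (n * CARD('m))
     (\<lambda>(r, c). M (r div CARD('m)) (c div CARD('m))
        $ from_nat_into UNIV (r mod CARD('m)) $ from_nat_into UNIV (c mod CARD('m)))"

lemma block_mat_carrier [simp]:
  "block_mat n (M :: nat \<Rightarrow> nat \<Rightarrow> 'm::finite cmat) \<in> carrier_mat (n * CARD('m)) (n * CARD('m))"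
  by (simp add: block_mat_def)

text \<open>A kernel vector of the big matrix, cut into n blocks, is one column of a family X of
  matrix unknowns, and the block equations hold column by column.\<close>

lemma det_block_mat_nonzero_iff:
  fixes M :: "nat \<Rightarrow> nat \<Rightarrow> 'm::finite cmat"
  shows "Determinant.det (block_mat n M) \<noteq> 0 \<longleftrightarrow>
    (\<forall>X :: nat \<Rightarrow> 'm cmat. (\<forall>k<n. (\<Sum>j<n. M k j ** X j) = 0) \<longrightarrow> (\<forall>j<n. X j = 0))"
proof -
  define m where "m = CARD('m)"
  define f where "f = from_nat_into (UNIV :: 'm set)"
  have m: "m > 0" by (simp add: m_def)
  have f: "bij_betw f {..<m} UNIV"
    unfolding f_def m_def by (metis bij_betw_from_nat_into_finite finite)
  define g where "g = inv_into {..<m} f"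
  have gf: "g (f i) = i" if "i < m" for i
    using f that by (simp add: g_def bij_betw_def)
  have fg: "f (g x) = x" "g x < m" for x
    using f bij_betw_inv_into_right[OF f] bij_betw_inv_into[OF f]
    by (auto simp: g_def bij_betw_def)
  have bound: "j * m + g x < n * m" if "j < n" for j x
  proof -
    have "j * m + g x < Suc j * m" using fg(2)[of x] by simp
    also have "\<dots> \<le> n * m" using that by (intro mult_le_mono1) simp
    finally show ?thesis .
  qed
  have split_less: "c div m < n" if "c < n * m" for c
    using that by (simp add: less_mult_imp_div_less)
  have div_mod [simp]: "(j * m + g x) div m = j" "(j * m + g x) mod m = g x" for j x
    using fg(2)[of x] m by auto
  have g_mod [simp]: "g (f (c mod m)) = c mod m" for c
    using gf m by simp
  let ?B = "block_mat n M"
  have B: "?B \<in> carrier_mat (n * m) (n * m)" by (simp add: block_mat_def m_def)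
  have sum_split: "(\<Sum>c\<in>{0..<n * m}. F (c div m) (f (c mod m))) = (\<Sum>j<n. \<Sum>x\<in>UNIV. F j x)"
    for F :: "nat \<Rightarrow> 'm \<Rightarrow> complex"
    unfolding sum.cartesian_product
    by (rule sum.reindex_bij_witness[of _ "\<lambda>(j, x). j * m + g x" "\<lambda>c. (c div m, f (c mod m))"])
      (auto simp: fg bound split_less)
  have mult: "vec_index (?B *\<^sub>v v) r = (\<Sum>j<n. M (r div m) j ** X j) $ f (r mod m) $ l"
    if r: "r < n * m" and v: "v = Matrix.vec (n * m) (\<lambda>c. X (c div m) $ f (c mod m) $ l)" for v r X l
  proof -
    have "vec_index (?B *\<^sub>v v) r = (\<Sum>c\<in>{0..<n * m}.
        M (r div m) (c div m) $ f (r mod m) $ f (c mod m) * X (c div m) $ f (c mod m) $ l)"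
      using r by (simp add: v block_mat_def scalar_prod_def m_def f_def)
    also have "\<dots> = (\<Sum>j<n. \<Sum>x\<in>UNIV. M (r div m) j $ f (r mod m) $ x * X j $ x $ l)"
      by (rule sum_split)
    also have "\<dots> = (\<Sum>j<n. M (r div m) j ** X j) $ f (r mod m) $ l"
      by (simp add: matrix_matrix_mult_def)
    finally show ?thesis .
  qed
  show ?thesis
  proof
    assume det: "Determinant.det ?B \<noteq> 0"
    show "\<forall>X :: nat \<Rightarrow> 'm cmat. (\<forall>k<n. (\<Sum>j<n. M k j ** X j) = 0) \<longrightarrow> (\<forall>j<n. X j = 0)"
    proof (intro allI impI)
      fix X :: "nat \<Rightarrow> 'm cmat" and j
      assume X: "\<forall>k<n. (\<Sum>j<n. M k j ** X j) = 0" and j: "j < n"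
      have "X j $ x $ l = 0" for x l
      proof -
        define v where "v = Matrix.vec (n * m) (\<lambda>c. X (c div m) $ f (c mod m) $ l)"
        have v: "v \<in> carrier_vec (n * m)" by (simp add: v_def)
        have "?B *\<^sub>v v = 0\<^sub>v (n * m)"
          using B mult[OF _ v_def] X split_less by (intro eq_vecI) auto
        then have v0: "v = 0\<^sub>v (n * m)"
          using det det_0_iff_vec_prod_zero[OF B] v by blast
        have "X j $ x $ l = vec_index v (j * m + g x)"
          using bound[OF j, of x] by (simp add: v_def fg)
        then show ?thesis using bound[OF j, of x] by (simp add: v0)
      qed
      then show "X j = 0" by (simp add: Finite_Cartesian_Product.vec_eq_iff)
    qed
  next
    assume inj: "\<forall>X :: nat \<Rightarrow> 'm cmat. (\<forall>k<n. (\<Sum>j<n. M k j ** X j) = 0) \<longrightarrow> (\<forall>j<n. X j = 0)"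
    show "Determinant.det ?B \<noteq> 0"
    proof
      assume "Determinant.det ?B = 0"
      then obtain v where v: "v \<in> carrier_vec (n * m)" "v \<noteq> 0\<^sub>v (n * m)" "?B *\<^sub>v v = 0\<^sub>v (n * m)"
        using det_0_iff_vec_prod_zero[OF B] by blast
      \<comment> \<open>All columns of X j are the same block of v. So \<open>v_eq\<close> holds for
        every column index l, and an arbitrary one recovers v at the end.\<close>
      define X :: "nat \<Rightarrow> 'm cmat" where "X j = (\<chi> x l. vec_index v (j * m + g x))" for j
      have v_eq: "v = Matrix.vec (n * m) (\<lambda>c. X (c div m) $ f (c mod m) $ l)" for l
        using v(1) by (intro eq_vecI) (auto simp: X_def)
      have "(\<Sum>j<n. M k j ** X j) $ x $ l = 0" if "k < n" for k x l
        using mult[OF bound[OF that, of x] v_eq, of l] v(3) bound[OF that, of x] by (simp add: fg)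
      then have "\<forall>k<n. (\<Sum>j<n. M k j ** X j) = 0"
        by (simp add: Finite_Cartesian_Product.vec_eq_iff)
      then have "\<forall>j<n. X j = 0" using inj by blast
      then have "v = 0\<^sub>v (n * m)"
        by (subst v_eq[of undefined], intro eq_vecI) (auto simp: split_less)
      then show False using v by simp
    qed
  qed
qed

lemma block_hankel_eq_block_mat: "block_hankel u n = block_mat (Suc n) (\<lambda>k j. moment u (k + j))"
  by (simp add: block_hankel_def block_mat_def Let_def)

lemma transpose_block_mat:
  "transpose_mat (block_mat n M) = block_mat n (\<lambda>k j. transpose (M j k))"
  by (rule eq_matI) (auto simp: block_mat_def transpose_def)

lemma coeff_sum_monom:
  "coeff (\<Sum>j<n. monom (X j) j) k = (if k < n then X k else (0 :: 'm::finite cmat))"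
  by (simp add: coeff_sum sum.delta)

text \<open>Row k of the block Hankel matrix, applied to the coefficients of Q, is the pairing of uQ
  with x^k. Here n counts coefficients, so it corresponds to \<Delta> of index n - 1, and n = 0 is
  trivial.\<close>

lemma quasi_definite_iff_right:
  "quasi_definite u \<longleftrightarrow> (\<forall>n Q. (\<forall>k\<ge>n. coeff Q k = 0) \<and>
     (\<forall>k<n. fun_mult u Q (monom (Finite_Cartesian_Product.mat 1) k) = 0) \<longrightarrow> Q = 0)" (is "_ \<longleftrightarrow> ?R")
  for u :: "'m::finite mfunctional"
proof -
  have eq: "fun_mult u Q (monom (Finite_Cartesian_Product.mat 1) k) = (\<Sum>j<n. moment u (k + j) ** coeff Q j)"
    if "\<forall>k\<ge>n. coeff Q k = 0" for Q k n
    using that by (simp add: fun_mult_eq_sum_lessThan[of n Q] xpow_mult_monom moment_def add.commute)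
  have "quasi_definite u \<longleftrightarrow> (\<forall>n (X :: nat \<Rightarrow> 'm cmat). (\<forall>k<Suc n. (\<Sum>j<Suc n. moment u (k + j) ** X j) = 0) \<longrightarrow> (\<forall>j<Suc n. X j = 0))"
    unfolding quasi_definite_def block_hankel_eq_block_mat det_block_mat_nonzero_iff by blast
  also have "\<dots> \<longleftrightarrow> ?R"
  proof (intro iffI allI impI)
    fix n Q
    assume inj: "\<forall>n (X :: nat \<Rightarrow> 'm cmat). (\<forall>k<Suc n. (\<Sum>j<Suc n. moment u (k + j) ** X j) = 0) \<longrightarrow> (\<forall>j<Suc n. X j = 0)"
      and Q: "(\<forall>k\<ge>n. coeff Q k = 0) \<and> (\<forall>k<n. fun_mult u Q (monom (Finite_Cartesian_Product.mat 1) k) = 0)"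
    show "Q = 0"
    proof (cases n)
      case 0
      then show ?thesis using Q by (simp add: poly_eq_iff)
    next
      case (Suc n')
      have "\<forall>k<Suc n'. (\<Sum>j<Suc n'. moment u (k + j) ** coeff Q j) = 0"
        using Q eq[of n Q] unfolding Suc by simp
      then have "\<forall>j<Suc n'. coeff Q j = 0" using inj by blast
      then show ?thesis using Q unfolding Suc by (metis leading_coeff_0_iff not_le)
    qed
  next
    fix n j and X :: "nat \<Rightarrow> 'm cmat"
    assume inj: ?R and X: "\<forall>k<Suc n. (\<Sum>j<Suc n. moment u (k + j) ** X j) = 0" and j: "j < Suc n"
    define Q where "Q = (\<Sum>j<Suc n. monom (X j) j)"
    have coeff_Q: "coeff Q k = (if k < Suc n then X k else 0)" for k
      unfolding Q_def by (rule coeff_sum_monom)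
    then have high: "\<forall>k\<ge>Suc n. coeff Q k = 0" by simp
    have "\<forall>k<Suc n. fun_mult u Q (monom (Finite_Cartesian_Product.mat 1) k) = 0"
      using X by (simp add: eq[OF high] coeff_Q del: sum.lessThan_Suc)
    then have "Q = 0" using inj high by blast
    then show "X j = 0" using coeff_Q[of j] j by simp
  qed
  finally show ?thesis .
qed

text \<open>The coefficients of P multiply the moments from the left. Transposing the block matrix
  puts the unknowns on the right and preserves the determinant.\<close>

lemma quasi_definite_iff_left:
  fixes u :: "'m::finite mfunctional"
  assumes "left_linear u"
  shows "quasi_definite u \<longleftrightarrow>
    (\<forall>n P. (\<forall>k\<ge>n. coeff P k = 0) \<and> (\<forall>k<n. u (xpow_mult k P) = 0) \<longrightarrow> P = 0)" (is "_ \<longleftrightarrow> ?L")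
proof -
  have transpose_0_iff: "transpose A = 0 \<longleftrightarrow> A = 0" for A :: "'m cmat"
    by (auto simp: transpose_def Finite_Cartesian_Product.vec_eq_iff)
  have transpose_sum: "transpose (\<Sum>j<n. A j ** B j) = (\<Sum>j<n. transpose (B j) ** transpose (A j))"
    for n and A B :: "nat \<Rightarrow> 'm cmat"
    by (simp add: matrix_transpose_mul[symmetric])
      (simp add: transpose_def Finite_Cartesian_Product.vec_eq_iff)
  have eq: "u (xpow_mult k P) = (\<Sum>j<n. coeff P j ** moment u (j + k))"
    if "\<forall>k\<ge>n. coeff P k = 0" for P k n
  proof -
    have "u (xpow_mult k P) = fun_mult u (monom (Finite_Cartesian_Product.mat 1) k) P"
      by (simp add: fun_mult_monom)
    also have "\<dots> = (\<Sum>j<n. coeff P j ** moment (fun_mult u (monom (Finite_Cartesian_Product.mat 1) k)) j)"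
      using that by (intro left_linear_moments left_linear_fun_mult assms) auto
    also have "\<dots> = (\<Sum>j<n. coeff P j ** moment u (j + k))"
      by (simp add: moment_def fun_mult_monom xpow_mult_monom add.commute)
    finally show ?thesis .
  qed
  have "quasi_definite u \<longleftrightarrow> (\<forall>n. Determinant.det (transpose_mat (block_mat (Suc n) (\<lambda>k j. moment u (k + j)))) \<noteq> 0)"
    unfolding quasi_definite_def block_hankel_eq_block_mat
    by (simp only: det_transpose[OF block_mat_carrier])
  also have "\<dots> \<longleftrightarrow> (\<forall>n (X :: nat \<Rightarrow> 'm cmat). (\<forall>k<Suc n. (\<Sum>j<Suc n. transpose (moment u (j + k)) ** X j) = 0) \<longrightarrow> (\<forall>j<Suc n. X j = 0))"
    by (simp only: transpose_block_mat det_block_mat_nonzero_iff)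
  also have "\<dots> \<longleftrightarrow> ?L"
  proof (intro iffI allI impI)
    fix n P
    assume inj: "\<forall>n (X :: nat \<Rightarrow> 'm cmat). (\<forall>k<Suc n. (\<Sum>j<Suc n. transpose (moment u (j + k)) ** X j) = 0) \<longrightarrow> (\<forall>j<Suc n. X j = 0)"
      and P: "(\<forall>k\<ge>n. coeff P k = 0) \<and> (\<forall>k<n. u (xpow_mult k P) = 0)"
    show "P = 0"
    proof (cases n)
      case 0
      then show ?thesis using P by (simp add: poly_eq_iff)
    next
      case (Suc n')
      have "\<forall>k<Suc n'. (\<Sum>j<Suc n'. transpose (moment u (j + k)) ** transpose (coeff P j)) = 0"
        unfolding transpose_sum[symmetric] transpose_0_iff
        using P eq[of n P] unfolding Suc by simp
      then have "\<forall>j<Suc n'. transpose (coeff P j) = 0"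
        by (rule inj[THEN spec, THEN spec, THEN mp])
      then have "\<forall>j<Suc n'. coeff P j = 0"
        unfolding transpose_0_iff .
      then show ?thesis using P unfolding Suc by (metis leading_coeff_0_iff not_le)
    qed
  next
    fix n j and X :: "nat \<Rightarrow> 'm cmat"
    assume inj: ?L and X: "\<forall>k<Suc n. (\<Sum>j<Suc n. transpose (moment u (j + k)) ** X j) = 0" and j: "j < Suc n"
    define P where "P = (\<Sum>j<Suc n. monom (transpose (X j)) j)"
    have coeff_P: "coeff P k = (if k < Suc n then transpose (X k) else 0)" for k
      unfolding P_def by (rule coeff_sum_monom)
    then have high: "\<forall>k\<ge>Suc n. coeff P k = 0" by simp
    have "u (xpow_mult k P) = 0" if "k < Suc n" for k
    proof -
      have "u (xpow_mult k P) = (\<Sum>j<Suc n. transpose (X j) ** moment u (j + k))"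
        unfolding eq[OF high] by (rule sum.cong) (simp_all add: coeff_P)
      also have "transpose \<dots> = 0"
        unfolding transpose_sum using X that by simp
      finally show ?thesis
        using transpose_0_iff by blast
    qed
    then have "P = 0" using inj high by blast
    then show "X j = 0" using coeff_P[of j] j by (simp add: transpose_0_iff)
  qed
  finally show ?thesis .
qed

subsection \<open>Matrix orthogonal polynomials\<close>

lemma is_MOPD:
  assumes "is_MOP u Q"
  shows "degree (Q n) = n" "invertible (coeff (Q n) n)" "k < n \<Longrightarrow> u (xpow_mult k (Q n)) = 0"
    "invertible (u (xpow_mult n (Q n)))"
  using assms unfolding is_MOP_def by metis+

text \<open>Used to pass between the derivatives and their monic multiples.\<close>

lemma is_MOP_lsmult:
  assumes lin: "left_linear u" and Q: "is_MOP u Q" and A: "\<And>n. invertible (A n)"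
  shows "is_MOP u (\<lambda>n. A n *\<^sub>l Q n)"
  unfolding is_MOP_def
proof (intro allI conjI impI)
  fix n
  have inv: "invertible (coeff (A n *\<^sub>l Q n) n)"
    by (simp add: invertible_mult A is_MOPD(2)[OF Q])
  have "coeff (A n *\<^sub>l Q n) n \<noteq> 0"
    using inv by (rule invertible_imp_nonzero)
  moreover have "coeff (A n *\<^sub>l Q n) k = 0" if "k > n" for k
    using that is_MOPD(1)[OF Q, of n] by (simp add: coeff_eq_0)
  ultimately show deg: "degree (A n *\<^sub>l Q n) = n"
    by (rule degree_eqI)
  show "invertible (lead_coeff (A n *\<^sub>l Q n))"
    using inv by (simp only: deg)
  show "u (xpow_mult k (A n *\<^sub>l Q n)) = 0" if "k < n" for k
    using that by (simp add: left_linear_lsmult[OF lin] is_MOPD(3)[OF Q])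
  show "invertible (u (xpow_mult n (A n *\<^sub>l Q n)))"
    by (simp add: left_linear_lsmult[OF lin] invertible_mult A is_MOPD(4)[OF Q])
qed

text \<open>One step of the expansion in a sequence with non-singular leading coefficients: C is the
  coefficient of P at n times the inverse of that of Q.\<close>

lemma split_leading_term:
  assumes "degree Q = n" "invertible (coeff Q n)" "\<And>k. k \<ge> Suc n \<Longrightarrow> coeff P k = 0"
  obtains C R where "P = C *\<^sub>l Q + R" "\<And>k. k \<ge> n \<Longrightarrow> coeff R k = 0"
proof -
  obtain B where B: "B ** coeff Q n = Finite_Cartesian_Product.mat 1"
    using assms(2) unfolding invertible_left_inverse by blast
  define C where "C = coeff P n ** B"
  have "coeff (P - C *\<^sub>l Q) k = 0" if "k \<ge> n" for k
  proof (cases "k = n")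
    case True
    then show ?thesis by (simp add: C_def matrix_mul_assoc[symmetric] B)
  next
    case False
    then show ?thesis using that assms by (simp add: coeff_eq_0)
  qed
  then show thesis by (intro that[of C "P - C *\<^sub>l Q"]) auto
qed

text \<open>Split P as C Q_n + R. Pairing with x^k for k < n does not see Q_n, so R = 0 by
  induction; pairing with x^n then gives C = 0.\<close>

lemma is_MOP_imp_quasi_definite:
  assumes lin: "left_linear u" and Q: "is_MOP u Q"
  shows "quasi_definite u"
  unfolding quasi_definite_iff_left[OF lin]
proof (intro allI impI)
  fix n P
  assume "(\<forall>k\<ge>n. coeff P k = 0) \<and> (\<forall>k<n. u (xpow_mult k P) = 0)"
  then show "P = 0"
  proof (induction n arbitrary: P)
    case 0
    then show ?case by (simp add: poly_eq_iff)
  next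
    case (Suc n)
    obtain C R where P: "P = C *\<^sub>l Q n + R" and R: "\<And>k. k \<ge> n \<Longrightarrow> coeff R k = 0"
      using split_leading_term[of "Q n" n P] is_MOPD(1,2)[OF Q] Suc.prems by blast
    have u_P: "u (xpow_mult k P) = C ** u (xpow_mult k (Q n)) + u (xpow_mult k R)" for k
      by (simp add: P left_linear_add[OF lin] left_linear_lsmult[OF lin])
    have "u (xpow_mult k R) = 0" if "k < n" for k
      using u_P[of k] that is_MOPD(3)[OF Q that] Suc.prems by simp
    then have R0: "R = 0" using Suc.IH R by blast
    have "C ** u (xpow_mult n (Q n)) = 0"
      using u_P[of n] Suc.prems by (simp add: R0 left_linear_zero[OF lin])
    then have "C = 0" using invertible_mult_eq_0_right is_MOPD(4)[OF Q] by blast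
    then show ?case by (simp add: P R0 poly_eq_iff)
  qed
qed

lemma left_linear_eq_0:
  assumes lin: "left_linear w" and Q: "is_MOP u Q" and w: "\<And>n. w (Q n) = 0"
  shows "w P = 0"
proof -
  have "w P = 0" if "\<forall>k\<ge>n. coeff P k = 0" for n P
    using that
  proof (induction n arbitrary: P)
    case 0
    then have "P = 0" by (simp add: poly_eq_iff)
    then show ?case by (simp add: left_linear_zero[OF lin])
  next
    case (Suc n)
    obtain C R where P: "P = C *\<^sub>l Q n + R" and R: "\<And>k. k \<ge> n \<Longrightarrow> coeff R k = 0"
      using split_leading_term[of "Q n" n P] is_MOPD(1,2)[OF Q] Suc.prems by blast
    then show ?case
      using Suc.IH[of R] by (simp add: left_linear_add[OF lin] left_linear_lsmult[OF lin] w)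
  qed
  from this[of "Suc (degree P)"] show ?thesis by (simp add: coeff_eq_0)
qed

text \<open>By orthogonality only the top coefficient of R survives. This evaluates all later
  pairings with the P_n.\<close>

lemma fun_mult_MOP:
  assumes Q: "is_MOP u Q" and R: "\<And>k. k \<ge> Suc n \<Longrightarrow> coeff R k = 0"
  shows "fun_mult u R (Q n) = u (xpow_mult n (Q n)) ** coeff R n"
  using fun_mult_eq_sum_lessThan[of "Suc n" R u "Q n"] R by (simp add: is_MOPD(3)[OF Q])

lemma fun_mult_xpow_mult: "fun_mult u (xpow_mult k Q) P = fun_mult u Q (xpow_mult k P)"
  by (induction k arbitrary: P) (simp_all add: fun_mult_pCons xpow_mult_pCons_0)

text \<open>The functionals u x^k A are triangular on the sequence Q_n. The highest value w(Q_N) is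
  removed by a monomial S of degree N, and the rest follows by induction.\<close>

lemma functional_eq_fun_mult:
  assumes Q: "is_MOP u Q" and lin: "left_linear u" and "left_linear w"
    and "\<And>n. n \<ge> N \<Longrightarrow> w (Q n) = 0"
  shows "\<exists>R. (\<forall>k\<ge>N. coeff R k = 0) \<and> w = fun_mult u R"
  using assms(3,4)
proof (induction N arbitrary: w)
  case 0
  then have "w P = 0" for P using left_linear_eq_0[OF _ Q] by blast
  then have "w = fun_mult u 0" by (intro ext) simp
  then show ?case by (intro exI[of _ 0]) simp
next
  case (Suc N)
  obtain B where B: "u (xpow_mult N (Q N)) ** B = Finite_Cartesian_Product.mat 1"
    using is_MOPD(4)[OF Q] unfolding invertible_right_inverse by blast
  \<comment> \<open>B inverts the norm of Q_N, so that uS takes the value w(Q_N) there and vanishes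
    on all later Q_n.\<close>
  define S where "S = monom (B ** w (Q N)) N"
  have S: "fun_mult u S (Q n) = (if n = N then w (Q N) else 0)" if "n \<ge> N" for n
    using that by (subst fun_mult_MOP[OF Q]) (auto simp: S_def matrix_mul_assoc B)
  let ?w = "\<lambda>P. w P - fun_mult u S P"
  have "\<exists>R. (\<forall>k\<ge>N. coeff R k = 0) \<and> ?w = fun_mult u R"
  proof (rule Suc.IH)
    show "left_linear ?w"
      by (intro left_linear_diff_functional Suc.prems left_linear_fun_mult lin)
    show "?w (Q n) = 0" if "n \<ge> N" for n
      using S[OF that] Suc.prems(2)[of n] that by auto
  qed
  then obtain R where R: "\<forall>k\<ge>N. coeff R k = 0" "?w = fun_mult u R" by blast
  have "w P = fun_mult u (R + S) P" for P
    using fun_cong[OF R(2), of P] by (simp add: fun_mult_add algebra_simps)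
  moreover have "\<forall>k\<ge>Suc N. coeff (R + S) k = 0" using R by (simp add: S_def)
  ultimately show ?case by (intro exI[of _ "R + S"]) auto
qed

lemma degree_mderiv_MOP:
  assumes "is_MOP u P"
  shows "degree (mderiv (P (Suc n))) = n" "invertible (coeff (mderiv (P (Suc n))) n)"
proof -
  show inv: "invertible (coeff (mderiv (P (Suc n))) n)"
    using is_MOPD(2)[OF assms, of "Suc n"] by (simp add: scalar_invertible del: of_nat_Suc)
  have "coeff (mderiv (P (Suc n))) n \<noteq> 0"
    using inv by (rule invertible_imp_nonzero)
  moreover have "coeff (mderiv (P (Suc n))) k = 0" if "k > n" for k
    using that is_MOPD(1)[OF assms, of "Suc n"] by (simp add: coeff_eq_0)
  ultimately show "degree (mderiv (P (Suc n))) = n"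
    by (rule degree_eqI)
qed

subsection \<open>Orthogonal derivatives and the Pearson equation\<close>

text \<open>Dv vanishes on P_n for n >= 2, and v for n >= 3, which gives \<Psi> and \<Phi> with the
  required degrees. If \<Phi>Q = 0 then vQ = 0, so Q = 0 because v is quasi-definite; hence the
  determinant of \<Phi> is not zero.\<close>

lemma derivative_MOP_imp_pearson:
  assumes lu: "left_linear u" and P: "is_MOP u P"
    and lv: "left_linear v" and D: "is_MOP v (\<lambda>n. mderiv (P (Suc n)))"
  shows "\<exists>\<Phi> \<Psi>. pearson_pair u \<Phi> \<Psi> \<and> v = fun_mult u \<Phi>"
proof -
  have "fun_deriv v (P n) = 0" if "n \<ge> 2" for n
  proof -
    obtain j where "n = 2 + j" using \<open>n \<ge> 2\<close> le_Suc_ex by blast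
    then show ?thesis using is_MOPD(3)[OF D, of 0 "Suc j"] by (simp add: fun_deriv_def)
  qed
  then obtain \<Psi> where \<Psi>: "\<forall>k\<ge>2. coeff \<Psi> k = 0" "fun_deriv v = fun_mult u \<Psi>"
    using functional_eq_fun_mult[OF P lu left_linear_fun_deriv[OF lv], of 2] by blast
  \<comment> \<open>From D(vx) = v + (Dv)x.\<close>
  have "v (P n) = 0" if "n \<ge> 3" for n
  proof -
    obtain j where "n = 3 + j" using \<open>n \<ge> 3\<close> le_Suc_ex by blast
    then have n: "n = Suc (Suc (Suc j))" by simp
    have "- v (P n) - v (pCons 0 (mderiv (P n))) = fun_deriv v (pCons 0 (P n))"
      by (simp add: fun_deriv_def mderiv_pCons_0 left_linear_add[OF lv])
    also have "\<dots> = fun_mult u (pCons 0 \<Psi>) (P n)"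
      by (simp add: \<Psi>(2) fun_mult_pCons)
    also have "\<dots> = 0"
      using \<Psi>(1) n by (subst fun_mult_MOP[OF P]) (auto simp: coeff_pCons split: nat.splits)
    finally show ?thesis
      using is_MOPD(3)[OF D, of 1 "Suc (Suc j)"] by (simp add: n)
  qed
  then obtain \<Phi> where \<Phi>: "\<forall>k\<ge>3. coeff \<Phi> k = 0" "v = fun_mult u \<Phi>"
    using functional_eq_fun_mult[OF P lu lv, of 3] by blast
  have "mpoly_det \<Phi> \<noteq> 0"
    unfolding mpoly_det_nonzero_iff
  proof (intro allI impI)
    fix Q assume "mpmult \<Phi> Q = 0"
    then have "fun_mult v Q X = 0" for X
      unfolding \<Phi>(2) fun_mult_mpmult[symmetric] by simp
    moreover have "quasi_definite v" using is_MOP_imp_quasi_definite[OF lv D] .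
    ultimately show "Q = 0"
      unfolding quasi_definite_iff_right
      by (metis Suc_le_eq coeff_eq_0)
  qed
  moreover have "degree \<Phi> \<le> 2" "degree \<Psi> \<le> 1"
    using \<Phi>(1) \<Psi>(1) by (auto intro!: degree_le)
  ultimately show ?thesis
    using \<Phi>(2) \<Psi>(2) unfolding pearson_pair_def by auto
qed

text \<open>The coefficients are parameters, since the recurrence is needed both for P_n and for the
  monic multiples of the derivatives. The same holds for \<open>deriv_structure\<close>.\<close>

definition monic_rec :: "(nat \<Rightarrow> 'm::finite mpoly) \<Rightarrow> (nat \<Rightarrow> 'm cmat) \<Rightarrow> (nat \<Rightarrow> 'm cmat) \<Rightarrow> bool" where
  "monic_rec P \<beta> \<gamma> \<longleftrightarrow>
     (\<forall>n. degree (P n) = n \<and> lead_coeff (P n) = Finite_Cartesian_Product.mat 1) \<and>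
     (\<forall>n. pCons 0 (P n) = P (Suc n) + \<beta> n *\<^sub>l P n + \<gamma> n *\<^sub>l pred_term P n)"

definition deriv_structure :: "(nat \<Rightarrow> 'm::finite mpoly) \<Rightarrow> (nat \<Rightarrow> 'm cmat) \<Rightarrow> (nat \<Rightarrow> 'm cmat) \<Rightarrow> bool" where
  "deriv_structure P a b \<longleftrightarrow>
     (\<forall>n. P n = Finite_Cartesian_Product.mat (1 / of_nat (Suc n)) *\<^sub>l mderiv (P (Suc n))
        + a n *\<^sub>l mderiv (P n) + b n *\<^sub>l mderiv (pred_term P n))"

lemma monic_recD:
  assumes "monic_rec P \<beta> \<gamma>"
  shows "degree (P n) = n" "coeff (P n) n = Finite_Cartesian_Product.mat 1"
    "pCons 0 (P n) = P (Suc n) + \<beta> n *\<^sub>l P n + \<gamma> n *\<^sub>l pred_term P n"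
  using assms unfolding monic_rec_def by metis+

section \<open>Consequences of a Pearson equation for the derivatives\<close>

locale pearson_MOP =
  fixes u :: "'m::finite mfunctional" and P :: "nat \<Rightarrow> 'm mpoly" and \<Phi> \<Psi> :: "'m mpoly"
  assumes lu: "left_linear u" and P: "is_MOP u P" and pearson: "pearson_pair u \<Phi> \<Psi>"
begin

definition v :: "'m mfunctional" where "v = fun_mult u \<Phi>"

text \<open>\<open>h n\<close> and \<open>k n\<close> are the norms of P_n for u and of P_{n+1}' for
  v; \<open>d n\<close> is \<psi>_1 + n \<phi>_2, which links them in \<open>k_eq\<close>.\<close>

abbreviation h :: "nat \<Rightarrow> 'm cmat" where "h n \<equiv> u (xpow_mult n (P n))"
abbreviation k :: "nat \<Rightarrow> 'm cmat" where "k n \<equiv> v (xpow_mult n (mderiv (P (Suc n))))"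
abbreviation d :: "nat \<Rightarrow> 'm cmat" where "d n \<equiv> coeff \<Psi> 1 + real n *\<^sub>R coeff \<Phi> 2"

lemma deg: "j > 2 \<Longrightarrow> coeff \<Phi> j = 0" "j > 1 \<Longrightarrow> coeff \<Psi> j = 0"
  using pearson by (auto simp: pearson_pair_def coeff_eq_0)

lemma lv: "left_linear v"
  unfolding v_def by (rule left_linear_fun_mult[OF lu])

lemma qu: "quasi_definite u"
  by (rule is_MOP_imp_quasi_definite[OF lu P])

lemma v_mderiv: "v (mderiv X) = - fun_mult u \<Psi> X"
  using pearson unfolding pearson_pair_def fun_deriv_def v_def by (metis minus_minus)

text \<open>Integration by parts. In the Horner induction on G the identity x X' = (x X)' - X moves
  the factor x into the argument, hence the arbitrary X.\<close>

lemma fun_mult_v_mderiv: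
  "fun_mult v G (mderiv X) = - fun_mult u (mpmult \<Psi> G + mpmult \<Phi> (mderiv G)) X"
proof (induction G arbitrary: X)
  case 0
  then show ?case by simp
next
  case (pCons A G)
  have "fun_mult v G (mderiv (pCons 0 X)) = fun_mult v G X + fun_mult v G (pCons 0 (mderiv X))"
    unfolding mderiv_pCons_0 by (rule left_linear_add[OF left_linear_fun_mult[OF lv]])
  moreover have "mderiv (pCons A G) = G + pCons 0 (mderiv G)"
    by (rule poly_eqI) (auto simp: coeff_pCons algebra_simps split: nat.splits)
  ultimately show ?case
    using pCons.IH[of "pCons 0 X"]
    by (simp add: fun_mult_add fun_mult_pCons fun_mult_mpmult v_mderiv v_def[symmetric]
        matmul.minus_left algebra_simps)
qed

lemma qv: "quasi_definite v"
  unfolding quasi_definite_iff_right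
proof (intro allI impI)
  fix n G
  assume "(\<forall>j\<ge>n. coeff G j = 0) \<and> (\<forall>j<n. fun_mult v G (monom (Finite_Cartesian_Product.mat 1) j) = 0)"
  then have G: "\<And>j. j \<ge> n \<Longrightarrow> coeff G j = 0"
    and vG: "\<And>j. j < n \<Longrightarrow> fun_mult v G (monom (Finite_Cartesian_Product.mat 1) j) = 0"
    by auto
  let ?M = "mpmult \<Psi> G + mpmult \<Phi> (mderiv G)"
  have mderiv_monom: "mderiv (monom (Finite_Cartesian_Product.mat 1) (Suc j)) =
      Finite_Cartesian_Product.mat (of_nat (Suc j)) *\<^sub>l monom (Finite_Cartesian_Product.mat 1 :: 'm cmat) j" for j
    by (rule poly_eqI) (auto simp del: of_nat_Suc)
  have fun_mult_v_monom: "fun_mult v G (mderiv (monom (Finite_Cartesian_Product.mat 1) (Suc j))) =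
      real (Suc j) *\<^sub>R fun_mult v G (monom (Finite_Cartesian_Product.mat 1) j)" for j
    unfolding mderiv_monom left_linear_lsmult[OF left_linear_fun_mult[OF lv]] by (rule mat_of_nat_mult)
  have "?M = 0"
  proof -
    have "coeff ?M j = 0" if "j \<ge> Suc n" for j
    proof -
      have "coeff (mpmult \<Psi> G) j = 0"
        using pearson that G by (intro coeff_mpmult_eq_0[of _ 1 n]) (auto simp: pearson_pair_def)
      moreover have "coeff (mpmult \<Phi> (mderiv G)) j = 0"
      proof (cases n)
        case 0
        then have "mderiv G = 0" using G by (simp add: poly_eq_iff)
        then show ?thesis by simp
      next
        case (Suc n')
        then show ?thesis
          using pearson that G by (intro coeff_mpmult_eq_0[of _ 2 n']) (auto simp: pearson_pair_def)
      qed
      ultimately show ?thesis by simp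
    qed
    \<comment> \<open>G satisfies n conditions and n + 1 are required. The additional one, the
      pairing with 1, holds because the derivative of 1 is 0; the others come from integration by
      parts.\<close>
    moreover have "fun_mult u ?M (monom (Finite_Cartesian_Product.mat 1) j) = 0" if "j < Suc n" for j
    proof (cases j)
      case 0
      have "mderiv (monom (Finite_Cartesian_Product.mat 1) 0) = (0 :: 'm mpoly)"
        by (rule poly_eqI) simp
      then show ?thesis
        using fun_mult_v_mderiv[of G "monom (Finite_Cartesian_Product.mat 1) 0"]
          left_linear_zero[OF left_linear_fun_mult[OF lv]] 0 by simp
    next
      case (Suc i)
      then show ?thesis
        using fun_mult_v_mderiv[of G "monom (Finite_Cartesian_Product.mat 1) j"]
          fun_mult_v_monom[of i] vG[of i] that by simp
    qed
    ultimately show ?thesis using qu unfolding quasi_definite_iff_right by blast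
  qed
  \<comment> \<open>Every monomial is a derivative up to a non-zero factor, so u(\<Phi>G) vanishes
    on all monomials.\<close>
  then have "fun_mult v G (mderiv X) = 0" for X by (simp add: fun_mult_v_mderiv)
  then have "fun_mult u (mpmult \<Phi> G) (monom (Finite_Cartesian_Product.mat 1) j) = 0" for j
    using fun_mult_v_monom[of j] by (simp add: fun_mult_mpmult v_def[symmetric] del: of_nat_Suc)
  then have "mpmult \<Phi> G = 0"
    using qu unfolding quasi_definite_iff_right by (metis Suc_le_eq coeff_eq_0)
  then show "G = 0"
    using pearson unfolding pearson_pair_def mpoly_det_nonzero_iff by blast
qed

lemma v_xpow_mult_P: "v (xpow_mult j (P n)) = fun_mult u (xpow_mult j \<Phi>) (P n)"
  by (simp add: fun_mult_xpow_mult v_def)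

text \<open>Apply v to the derivative of x^j P_{n+1}. By Leibniz and Pearson this reduces to
  pairings of P_{n+1} with x^j \<Psi> and x^(j-1) \<Phi>, of degree at most j + 1, which are
  non-zero only if j = n.\<close>

lemma v_xpow_mult_mderiv:
  assumes "j \<le> n"
  shows "v (xpow_mult j (mderiv (P (Suc n)))) = (if j = n then - (h (Suc n) ** d n) else 0)"
proof -
  let ?X = "P (Suc n)"
  have "v (mderiv (xpow_mult j ?X)) = real j *\<^sub>R v (xpow_mult (j - 1) ?X) + v (xpow_mult j (mderiv ?X))"
    by (simp add: mderiv_xpow_mult left_linear_add[OF lv] left_linear_lsmult[OF lv])
  then have eq: "v (xpow_mult j (mderiv ?X)) =
      - fun_mult u (xpow_mult j \<Psi>) ?X - real j *\<^sub>R fun_mult u (xpow_mult (j - 1) \<Phi>) ?X"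
    by (simp add: v_mderiv v_xpow_mult_P fun_mult_xpow_mult algebra_simps)
  have \<Psi>_term: "fun_mult u (xpow_mult j \<Psi>) ?X = h (Suc n) ** coeff (xpow_mult j \<Psi>) (Suc n)"
    using assms by (intro fun_mult_MOP[OF P]) (auto simp: deg)
  \<comment> \<open>For j = 0 truncation yields \<Phi> itself, whose degree may exceed n + 1; the
    weight j removes that term.\<close>
  have "fun_mult u (xpow_mult (j - 1) \<Phi>) ?X = h (Suc n) ** coeff (xpow_mult (j - 1) \<Phi>) (Suc n)" if "j \<noteq> 0"
    using assms that by (intro fun_mult_MOP[OF P]) (auto simp: deg)
  then have \<Phi>_term: "real j *\<^sub>R fun_mult u (xpow_mult (j - 1) \<Phi>) ?X =
      real j *\<^sub>R (h (Suc n) ** coeff (xpow_mult (j - 1) \<Phi>) (Suc n))"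
    by (cases "j = 0") auto
  show ?thesis
  proof (cases "j = n")
    case True
    have coeff_\<Phi>: "real n *\<^sub>R coeff (xpow_mult (n - 1) \<Phi>) (Suc n) = real n *\<^sub>R coeff \<Phi> 2"
      by (cases n) (simp_all add: numeral_2_eq_2)
    have "v (xpow_mult j (mderiv ?X)) = - (h (Suc n) ** coeff \<Psi> 1) -
        h (Suc n) ** (real n *\<^sub>R coeff (xpow_mult (n - 1) \<Phi>) (Suc n))"
      unfolding eq \<Psi>_term \<Phi>_term unfolding True
      by (simp add: matmul.scaleR_right del: xpow_mult_Suc)
    also have "\<dots> = - (h (Suc n) ** d n)"
      unfolding coeff_\<Phi> by (simp add: matmul.add_right)
    finally show ?thesis using True by simp
  next
    case False
    have "real j *\<^sub>R coeff (xpow_mult (j - 1) \<Phi>) (Suc n) = 0"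
    proof (cases "j = 0")
      case False
      then have "Suc n - (j - 1) > 2" using \<open>j \<noteq> n\<close> assms by linarith
      then show ?thesis by (simp add: deg(1) del: One_nat_def)
    qed simp
    then have "real j *\<^sub>R (h (Suc n) ** coeff (xpow_mult (j - 1) \<Phi>) (Suc n)) = 0"
      by (metis matmul.scaleR_right matmul.zero_right)
    moreover have "coeff (xpow_mult j \<Psi>) (Suc n) = 0"
      using False assms by (simp add: deg(2))
    ultimately show ?thesis unfolding eq \<Psi>_term \<Phi>_term using False by simp
  qed
qed

text \<open>If B annihilates \<open>k n\<close> from the left, B P_{n+1}' is orthogonal to x^j for
  all j <= n. It vanishes as v is quasi-definite, and its leading coefficient forces B = 0.\<close>

lemma derivative_MOP: "is_MOP v (\<lambda>n. mderiv (P (Suc n)))"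
  unfolding is_MOP_def
proof (intro allI conjI impI)
  fix n
  show "degree (mderiv (P (Suc n))) = n" by (rule degree_mderiv_MOP[OF P])
  show "invertible (lead_coeff (mderiv (P (Suc n))))"
    using degree_mderiv_MOP[OF P] by metis
  show orth: "v (xpow_mult j (mderiv (P (Suc n)))) = 0" if "j < n" for j
    using that v_xpow_mult_mderiv[of j n] by simp
  show "invertible (k n)"
  proof (rule not_invertible_left_kernel)
    fix B :: "'m cmat" assume B: "B ** k n = 0"
    let ?B = "B *\<^sub>l mderiv (P (Suc n))"
    have "v (xpow_mult j ?B) = 0" if "j < Suc n" for j
      using that orth B by (auto simp: left_linear_lsmult[OF lv] less_Suc_eq)
    moreover have "coeff ?B j = 0" if "j \<ge> Suc n" for j
      using that is_MOPD(1)[OF P, of "Suc n"] by (simp add: coeff_eq_0)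
    ultimately have "?B = 0"
      using qv unfolding quasi_definite_iff_left[OF lv] by blast
    then have "B ** coeff (mderiv (P (Suc n))) n = 0"
      by (metis coeff_0 coeff_lsmult)
    then show "B = 0"
      using invertible_mult_eq_0_right degree_mderiv_MOP(2)[OF P] by blast
  qed
qed

lemma k_eq: "k n = - (h (Suc n) ** d n)"
  using v_xpow_mult_mderiv[of n n] by simp

lemma invertible_d: "invertible (d n)"
  using is_MOPD(4)[OF derivative_MOP, of n] invertible_minus[of "k n"]
    invertible_cancel_right[of "h (Suc n)" "d n"] unfolding k_eq by simp

text \<open>The coefficient b 1 is arbitrary since \<open>P\<^sub>0' = 0\<close>; it is chosen to be 0.\<close>

lemma structure_relation:
  assumes rec: "monic_rec P \<beta> \<gamma>"
  obtains a b where "deriv_structure P a b" "b 1 = 0"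
    "\<And>n. b (Suc (Suc n)) ** k n = h (Suc (Suc n)) ** coeff \<Phi> 2"
proof -
  let ?Q = "\<lambda>n. Finite_Cartesian_Product.mat (1 / of_nat (Suc n)) *\<^sub>l mderiv (P (Suc n))"
  define S where "S n A B \<longleftrightarrow>
    P n = ?Q n + A *\<^sub>l mderiv (P n) + B *\<^sub>l mderiv (pred_term P n) \<and> (n = 1 \<longrightarrow> B = 0)" for n A B
  have "\<exists>A B. S n A B" for n
  proof (cases n)
    case 0
    have "P 0 = ?Q 0"
    proof (rule poly_eqI)
      fix j show "coeff (P 0) j = coeff (?Q 0) j"
        using monic_recD(1,2)[OF rec, of 0] monic_recD(1,2)[OF rec, of 1]
        by (cases j) (auto simp: coeff_eq_0)
    qed
    moreover have "mderiv (P 0) = 0"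
      using monic_recD(1)[OF rec, of 0] by (simp add: poly_eq_iff coeff_eq_0)
    ultimately have "S n 0 0"
      unfolding S_def 0 by (simp add: pred_term_def)
    then show ?thesis by blast
  next
    case n: (Suc m)
    have R0: "coeff (P n - ?Q n) j = 0" if "j \<ge> n" for j
      using that monic_recD(1,2)[OF rec, of n] monic_recD(1,2)[OF rec, of "Suc n"]
      by (cases "j = n") (auto simp: coeff_eq_0 scaleR_add_left[symmetric] simp del: of_nat_Suc)
    \<comment> \<open>The leading terms cancel in the difference of two monic polynomials of degree
      n. Multiples of P_n' and P_{n-1}' then remove the next two degrees.\<close>
    obtain A R where R: "P n - ?Q n = A *\<^sub>l mderiv (P n) + R" "\<And>j. j \<ge> m \<Longrightarrow> coeff R j = 0"
      using split_leading_term[of "mderiv (P n)" m "P n - ?Q n"] degree_mderiv_MOP[OF P, of m] R0 n by blast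
    have P_n: "P n = ?Q n + (A *\<^sub>l mderiv (P n) + R)"
      using diff_add_cancel[of "P n" "?Q n"] unfolding R(1) by (metis add.commute)
    show ?thesis
    proof (cases m)
      case 0
      then have "R = 0" using R(2) by (simp add: poly_eq_iff)
      then have "S n A 0"
        unfolding S_def by (intro conjI, intro trans[OF P_n]) (simp_all add: poly_eq_iff)
      then show ?thesis by blast
    next
      case m: (Suc l)
      obtain B T where T: "R = B *\<^sub>l mderiv (P m) + T" "\<And>j. j \<ge> l \<Longrightarrow> coeff T j = 0"
        using split_leading_term[of "mderiv (P m)" l R] degree_mderiv_MOP[OF P, of l] R(2) m by blast
      have T_eq: "T = P n - ?Q n - A *\<^sub>l mderiv (P n) - B *\<^sub>l mderiv (P m)"
      proof -
        have "T = R - B *\<^sub>l mderiv (P m)" using T(1) by simp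
        also have "R = P n - ?Q n - A *\<^sub>l mderiv (P n)" unfolding R(1) by simp
        finally show ?thesis .
      qed
      \<comment> \<open>The remainder T has degree below l = n - 2. It is orthogonal to x^j for j <
        l: the derivatives involved have degree at least l, and x^j \<Phi> has degree below
        n.\<close>
      have "v (xpow_mult j T) = 0" if "j < l" for j
      proof -
        have "v (xpow_mult j (P n)) = h n ** coeff (xpow_mult j \<Phi>) n"
          unfolding v_xpow_mult_P using that n m by (intro fun_mult_MOP[OF P]) (auto simp: deg)
        also have "\<dots> = 0" using that n m by (simp add: deg)
        finally show ?thesis
          using that n m v_xpow_mult_mderiv[of j n] v_xpow_mult_mderiv[of j m] v_xpow_mult_mderiv[of j l]
          by (simp add: T_eq left_linear_diff[OF lv] left_linear_lsmult[OF lv])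
      qed
      then have "T = 0"
        using qv T(2) unfolding quasi_definite_iff_left[OF lv] by blast
      then have R_eq: "R = B *\<^sub>l mderiv (pred_term P n)"
        using T(1) n by (simp add: pred_term_def)
      have "S n A B"
        unfolding S_def
      proof
        show "P n = ?Q n + A *\<^sub>l mderiv (P n) + B *\<^sub>l mderiv (pred_term P n)"
          using P_n unfolding R_eq add.assoc .
        show "n = 1 \<longrightarrow> B = 0" using n m by simp
      qed
      then show ?thesis by blast
    qed
  qed
  then obtain a b where "\<And>n. S n (a n) (b n)"
    by metis
  then have ab: "P n = ?Q n + a n *\<^sub>l mderiv (P n) + b n *\<^sub>l mderiv (pred_term P n)"
    "n = 1 \<Longrightarrow> b n = 0" for n
    unfolding S_def by blast+
  have "b (Suc (Suc n)) ** k n = h (Suc (Suc n)) ** coeff \<Phi> 2" for n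
  proof -
    let ?n = "Suc (Suc n)"
    \<comment> \<open>The same value is computed twice: by the structure relation, where only
      P_{n+1}' contributes, and by the top coefficient of x^n \<Phi>.\<close>
    have "v (xpow_mult n (P ?n)) = b ?n ** k n"
      by (subst ab(1)[of ?n])
        (simp add: left_linear_add[OF lv] left_linear_lsmult[OF lv] v_xpow_mult_mderiv pred_term_def)
    moreover have "v (xpow_mult n (P ?n)) = h ?n ** coeff \<Phi> 2"
      unfolding v_xpow_mult_P by (subst fun_mult_MOP[OF P]) (auto simp: deg numeral_2_eq_2)
    ultimately show ?thesis by simp
  qed
  then show thesis using ab that[of a b] unfolding deriv_structure_def by blast
qed

text \<open>Pair the recurrence for x P_{n+1} with x^n; orthogonality leaves only the term in
  P_n.\<close>

lemma gamma_h:
  assumes rec: "monic_rec P \<beta> \<gamma>"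
  shows "\<gamma> (Suc n) ** h n = h (Suc n)"
proof -
  have "h (Suc n) = u (xpow_mult n (pCons 0 (P (Suc n))))"
    by (simp add: xpow_mult_pCons_0)
  also have "\<dots> = \<gamma> (Suc n) ** h n"
    using is_MOPD(3)[OF P]
    by (subst monic_recD(3)[OF rec]) (simp add: left_linear_add[OF lu] left_linear_lsmult[OF lu] pred_term_def)
  finally show ?thesis by simp
qed

text \<open>From \<open>\<gamma>\<^sub>n h\<^sub>n\<^sub>-\<^sub>1 = h\<^sub>n\<close> and \<open>b\<^sub>n k\<^sub>n\<^sub>-\<^sub>2 = h\<^sub>n \<phi>\<^sub>2\<close> one gets
  \<open>(\<gamma>\<^sub>n - s b\<^sub>n) k\<^sub>n\<^sub>-\<^sub>2 = - h\<^sub>n d\<^sub>n\<^sub>-\<^sub>2\<^sub>+\<^sub>s\<close>. The case s = 2 is what the second derivatives need.\<close>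

lemma invertible_gamma_minus_b:
  assumes rec: "monic_rec P \<beta> \<gamma>"
    and b: "b (Suc (Suc n)) ** k n = h (Suc (Suc n)) ** coeff \<Phi> 2"
  shows "invertible (\<gamma> (Suc (Suc n)) - real s *\<^sub>R b (Suc (Suc n)))"
proof -
  let ?n = "Suc (Suc n)"
  have "(\<gamma> ?n - real s *\<^sub>R b ?n) ** k n = \<gamma> ?n ** k n - real s *\<^sub>R (b ?n ** k n)"
    by (simp add: matmul.diff_left matmul.scaleR_left)
  also have "\<gamma> ?n ** k n = - (h ?n ** d n)"
    unfolding k_eq matmul.minus_right matrix_mul_assoc gamma_h[OF rec] ..
  \<comment> \<open>Adding s \<phi>_2 to \<open>d n\<close> gives \<open>d (n + s)\<close>, another
    matrix of the non-singular family.\<close>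
  also have "- (h ?n ** d n) - real s *\<^sub>R (b ?n ** k n) = - (h ?n ** d (n + s))"
    unfolding b by (simp add: matmul.add_right matmul.scaleR_right algebra_simps)
  finally have "invertible ((\<gamma> ?n - real s *\<^sub>R b ?n) ** k n)"
    using invertible_minus invertible_mult is_MOPD(4)[OF P] invertible_d by metis
  then show ?thesis by (rule invertible_cancel_left)
qed

end

subsection \<open>The structure relation\<close>

lemma monic_rec_derivative:
  assumes rec: "monic_rec P \<beta> \<gamma>" and str: "deriv_structure P a b"
  defines "Q \<equiv> \<lambda>n. Finite_Cartesian_Product.mat (1 / of_nat (Suc n)) *\<^sub>l mderiv (P (Suc n))"
  shows "monic_rec Q (\<lambda>n. \<beta> (Suc n) - a (Suc n)) (\<lambda>n. (real n / real (Suc n)) *\<^sub>R (\<gamma> (Suc n) - b (Suc n)))"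
    and "deriv_structure Q (\<lambda>n. a (Suc n)) (\<lambda>n. (real n / real (Suc n)) *\<^sub>R b (Suc n))"
proof -
  have mderiv_P: "mderiv (P (Suc n)) = Finite_Cartesian_Product.mat (of_nat (Suc n)) *\<^sub>l Q n" for n
    by (rule poly_eqI) (simp add: Q_def del: of_nat_Suc)
  have mderiv_P_pred: "mderiv (P n) = Finite_Cartesian_Product.mat (of_nat n) *\<^sub>l pred_term Q n" for n
  proof (cases n)
    case 0
    then show ?thesis
      using monic_recD(1)[OF rec, of 0] by (simp add: poly_eq_iff pred_term_def coeff_eq_0)
  next
    case (Suc m)
    then show ?thesis using mderiv_P[of m] by (simp add: pred_term_def)
  qed
  have scale: "X = Y" if "real (Suc n) *\<^sub>R X = real (Suc n) *\<^sub>R Y" for X Y :: "'a cmat" and n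
    using that by simp
  have deg: "degree (Q n) = n \<and> lead_coeff (Q n) = Finite_Cartesian_Product.mat 1" for n
  proof -
    have lead: "coeff (Q n) n = Finite_Cartesian_Product.mat 1"
      using monic_recD(2)[OF rec, of "Suc n"] by (simp add: Q_def del: of_nat_Suc)
    have "degree (Q n) = n"
    proof (rule degree_eqI)
      show "coeff (Q n) n \<noteq> 0"
        unfolding lead by (rule invertible_imp_nonzero) (auto simp: invertible_def)
      show "coeff (Q n) k = 0" if "k > n" for k
        using that monic_recD(1)[OF rec, of "Suc n"] by (simp add: Q_def coeff_eq_0)
    qed
    then show ?thesis using lead by simp
  qed
  \<comment> \<open>Multiplied by n + 1 and read on coefficients. Fact 1 is the differentiated
    recurrence, and fact 2, the structure relation, eliminates P_{n+1} from it.\<close>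
  have "pCons 0 (Q n) = Q (Suc n) + (\<beta> (Suc n) - a (Suc n)) *\<^sub>l Q n
      + ((real n / real (Suc n)) *\<^sub>R (\<gamma> (Suc n) - b (Suc n))) *\<^sub>l pred_term Q n" for n
  proof (rule poly_eqI, rule scale[of n])
    fix k
    let ?x = "coeff (pCons 0 (Q n)) k" and ?p = "coeff (P (Suc n)) k"
    let ?qa = "coeff (Q (Suc n)) k" and ?qb = "coeff (Q n) k" and ?qc = "coeff (pred_term Q n) k"
    have "mderiv (pCons 0 (P (Suc n))) = mderiv (P (Suc (Suc n))) + \<beta> (Suc n) *\<^sub>l mderiv (P (Suc n))
        + \<gamma> (Suc n) *\<^sub>l mderiv (P n)"
      by (subst monic_recD(3)[OF rec]) (simp add: mderiv_add mderiv_lsmult pred_term_def)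
    then have "coeff (P (Suc n) + pCons 0 (mderiv (P (Suc n)))) k =
        coeff (mderiv (P (Suc (Suc n))) + \<beta> (Suc n) *\<^sub>l mderiv (P (Suc n)) + \<gamma> (Suc n) *\<^sub>l mderiv (P n)) k"
      by (simp only: mderiv_pCons_0)
    then have 1: "?p + real (Suc n) *\<^sub>R ?x = real (Suc (Suc n)) *\<^sub>R ?qa + real (Suc n) *\<^sub>R (\<beta> (Suc n) ** ?qb)
        + real n *\<^sub>R (\<gamma> (Suc n) ** ?qc)"
      unfolding mderiv_P mderiv_P_pred[of n] pCons_0_lsmult
      by (simp add: matmul.scaleR_right del: of_nat_Suc coeff_pCons)
    have "?p = coeff (Q (Suc n) + a (Suc n) *\<^sub>l mderiv (P (Suc n)) + b (Suc n) *\<^sub>l mderiv (P n)) k"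
      using str unfolding deriv_structure_def Q_def by (metis pred_term_def diff_Suc_1 nat.distinct(1))
    then have 2: "?p = ?qa + real (Suc n) *\<^sub>R (a (Suc n) ** ?qb) + real n *\<^sub>R (b (Suc n) ** ?qc)"
      unfolding mderiv_P mderiv_P_pred[of n] by (simp add: matmul.scaleR_right del: of_nat_Suc)
    have "real (Suc (Suc n)) = 1 + real (Suc n)" by simp
    then have 3: "real (Suc (Suc n)) *\<^sub>R ?qa = ?qa + real (Suc n) *\<^sub>R ?qa"
      by (simp only: scaleR_add_left scaleR_one)
    have "real (Suc n) *\<^sub>R ?x = real (Suc n) *\<^sub>R ?qa
        + (real (Suc n) *\<^sub>R (\<beta> (Suc n) ** ?qb) - real (Suc n) *\<^sub>R (a (Suc n) ** ?qb))
        + (real n *\<^sub>R (\<gamma> (Suc n) ** ?qc) - real n *\<^sub>R (b (Suc n) ** ?qc))"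
      using 1 unfolding 2 3 by (simp add: algebra_simps del: of_nat_Suc)
    then show "real (Suc n) *\<^sub>R ?x = real (Suc n) *\<^sub>R coeff (Q (Suc n) + (\<beta> (Suc n) - a (Suc n)) *\<^sub>l Q n
        + ((real n / real (Suc n)) *\<^sub>R (\<gamma> (Suc n) - b (Suc n))) *\<^sub>l pred_term Q n) k"
      by (simp add: matmul.diff_left matmul.scaleR_left scaleR_add_right scaleR_diff_right del: of_nat_Suc)
  qed
  then show "monic_rec Q (\<lambda>n. \<beta> (Suc n) - a (Suc n)) (\<lambda>n. (real n / real (Suc n)) *\<^sub>R (\<gamma> (Suc n) - b (Suc n)))"
    unfolding monic_rec_def using deg by blast
  show "deriv_structure Q (\<lambda>n. a (Suc n)) (\<lambda>n. (real n / real (Suc n)) *\<^sub>R b (Suc n))"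
    unfolding deriv_structure_def
  proof (intro allI poly_eqI, rule scale)
    fix n k
    \<comment> \<open>Here the structure relation itself is differentiated.\<close>
    have "mderiv (P (Suc n)) = mderiv (Q (Suc n) + a (Suc n) *\<^sub>l mderiv (P (Suc n)) + b (Suc n) *\<^sub>l mderiv (P n))"
      using str unfolding deriv_structure_def Q_def by (metis pred_term_def diff_Suc_1 nat.distinct(1))
    then have "coeff (mderiv (P (Suc n))) k =
        coeff (mderiv (Q (Suc n) + a (Suc n) *\<^sub>l mderiv (P (Suc n)) + b (Suc n) *\<^sub>l mderiv (P n))) k"
      by simp
    then show "real (Suc n) *\<^sub>R coeff (Q n) k = real (Suc n) *\<^sub>R coeff
        (Finite_Cartesian_Product.mat (1 / of_nat (Suc n)) *\<^sub>l mderiv (Q (Suc n)) + a (Suc n) *\<^sub>l mderiv (Q n)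
          + ((real n / real (Suc n)) *\<^sub>R b (Suc n)) *\<^sub>l mderiv (pred_term Q n)) k"
      unfolding mderiv_P mderiv_P_pred[of n] mderiv_add mderiv_lsmult
      by (simp add: matmul.scaleR_right matmul.scaleR_left scaleR_add_right mult.commute
          del: of_nat_Suc coeff_mderiv)
  qed
qed

subsection \<open>Favard's theorem\<close>

text \<open>Since Q_n is monic, the requirement v(Q_n) = 0 for n > 0 can be solved for the moment of
  index n; the moment of index 0 is normalised to the identity.\<close>

function favard_moment :: "(nat \<Rightarrow> 'm::finite mpoly) \<Rightarrow> nat \<Rightarrow> 'm cmat" where
  "favard_moment Q n = (if n = 0 then Finite_Cartesian_Product.mat 1
     else - (\<Sum>k<n. coeff (Q n) k ** favard_moment Q k))"
  by auto
termination by (relation "inv_image less_than snd") auto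

declare favard_moment.simps [simp del]

text \<open>The recurrence trades a power of x for a shift of the index. Orthogonality follows by
  induction on the power, and each norm is \<gamma>_n times the previous one.\<close>

lemma favard:
  fixes Q :: "nat \<Rightarrow> 'a::finite mpoly"
  assumes rec: "monic_rec Q \<beta> \<gamma>" and inv: "\<And>n. invertible (\<gamma> (Suc n))"
  shows "\<exists>v. left_linear v \<and> is_MOP v Q"
proof -
  define v where "v P = (\<Sum>k\<le>degree P. coeff P k ** favard_moment Q k)" for P :: "'a mpoly"
  have v_eq: "v P = (\<Sum>k\<le>n. coeff P k ** favard_moment Q k)" if "degree P \<le> n" for P n
    unfolding v_def using that by (intro sum.mono_neutral_left) (auto simp: coeff_eq_0)
  have lin: "left_linear v"
    unfolding left_linear_def
  proof (intro conjI allI)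
    fix P R A
    show "v (P + R) = v P + v R"
      using v_eq[of P "max (degree P) (degree R)"] v_eq[of R "max (degree P) (degree R)"]
        v_eq[OF degree_add_le_max[of P R]] by (simp add: matmul.add_left sum.distrib)
    have "degree (A *\<^sub>l P) \<le> degree P" by (rule degree_le) (simp add: coeff_eq_0)
    then show "v (A *\<^sub>l P) = A ** v P"
      by (simp add: v_eq[of _ "degree P"] matmul.sum_right matrix_mul_assoc)
  qed
  have v_0: "v (Q 0) = Finite_Cartesian_Product.mat 1"
    using monic_recD(1,2)[OF rec, of 0] by (simp add: v_def favard_moment.simps)
  have v_Suc: "v (Q (Suc n)) = 0" for n
  proof -
    have "v (Q (Suc n)) = (\<Sum>k<Suc n. coeff (Q (Suc n)) k ** favard_moment Q k) + favard_moment Q (Suc n)"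
      using monic_recD(1,2)[OF rec, of "Suc n"] by (simp add: v_def lessThan_Suc_atMost)
    then show ?thesis by (subst (asm) favard_moment.simps[of Q "Suc n"]) simp
  qed
  have step: "v (xpow_mult (Suc j) (Q n)) = v (xpow_mult j (Q (Suc n))) + \<beta> n ** v (xpow_mult j (Q n))
      + \<gamma> n ** v (xpow_mult j (pred_term Q n))" for j n
  proof -
    have "xpow_mult (Suc j) (Q n) = xpow_mult j (pCons 0 (Q n))" by (simp add: xpow_mult_pCons_0)
    then show ?thesis
      by (simp add: monic_recD(3)[OF rec, of n] left_linear_add[OF lin] left_linear_lsmult[OF lin]
          del: xpow_mult_Suc)
  qed
  have orth: "v (xpow_mult j (Q n)) = 0" if "j < n" for j n
    using that
  proof (induction j arbitrary: n)
    case 0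
    then show ?case using v_Suc by (cases n) auto
  next
    case (Suc j)
    then obtain m where "n = Suc m" by (cases n) auto
    then show ?case using Suc by (simp add: step pred_term_def del: xpow_mult_Suc)
  qed
  have norm: "invertible (v (xpow_mult n (Q n)))" for n
  proof (induction n)
    case 0
    then show ?case using v_0 by (auto simp: invertible_def)
  next
    case (Suc n)
    have "v (xpow_mult (Suc n) (Q (Suc n))) = \<gamma> (Suc n) ** v (xpow_mult n (Q n))"
      by (simp add: step orth pred_term_def del: xpow_mult_Suc)
    then show ?case using Suc.IH inv invertible_mult by metis
  qed
  have "is_MOP v Q"
    unfolding is_MOP_def
    using monic_recD(1,2)[OF rec] orth norm by (auto simp: invertible_def)
  then show ?thesis using lin by blast
qed

text \<open>Favard's theorem for the monic derivatives concerns their recurrence coefficients from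
  index 1 on, which are non-zero multiples of \<gamma>_n - b_n for n >= 2.\<close>

lemma deriv_structure_imp_MOP:
  assumes rec: "monic_rec P \<beta> \<gamma>" and str: "deriv_structure P a b"
    and inv: "\<And>n. invertible (\<gamma> (Suc (Suc n)) - b (Suc (Suc n)))"
  shows "\<exists>v. left_linear v \<and> is_MOP v (\<lambda>n. mderiv (P (Suc n)))"
proof -
  define Q where "Q = (\<lambda>n. Finite_Cartesian_Product.mat (1 / of_nat (Suc n)) *\<^sub>l mderiv (P (Suc n)))"
  have "monic_rec Q (\<lambda>n. \<beta> (Suc n) - a (Suc n)) (\<lambda>n. (real n / real (Suc n)) *\<^sub>R (\<gamma> (Suc n) - b (Suc n)))"
    unfolding Q_def by (rule monic_rec_derivative[OF rec str])
  moreover have "invertible ((real (Suc n) / real (Suc (Suc n))) *\<^sub>R (\<gamma> (Suc (Suc n)) - b (Suc (Suc n))))" for n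
    by (intro scalar_invertible inv) simp
  ultimately obtain v where v: "left_linear v" "is_MOP v Q"
    using favard by blast
  have inv_mat: "invertible (Finite_Cartesian_Product.mat (of_nat (Suc n)) :: 'a cmat)" for n
    using scalar_invertible[of "real (Suc n)" "Finite_Cartesian_Product.mat 1 :: 'a cmat"]
      mat_of_nat_mult[of "Suc n" "Finite_Cartesian_Product.mat 1 :: 'a cmat"]
    by (auto simp: invertible_def)
  have "mderiv (P (Suc n)) = Finite_Cartesian_Product.mat (of_nat (Suc n)) *\<^sub>l Q n" for n
    by (rule poly_eqI) (simp add: Q_def del: of_nat_Suc)
  then show ?thesis
    using is_MOP_lsmult[OF v inv_mat] v(1) by auto
qed

section \<open>The argument repeated for the functional of the derivatives\<close>

context pearson_MOP
begin

text \<open>The monic derivatives Q are MOP for v and inherit a recurrence and a structure relation.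
  Hence their derivatives are MOP for some w, and \<open>derivative_MOP_imp_pearson\<close> yields a
  Pearson equation for v.\<close>

lemma P21_derivative:
  assumes rec: "monic_rec P \<beta> \<gamma>"
  shows "P21_functional v"
proof -
  obtain a b where str: "deriv_structure P a b"
    and b: "\<And>n. b (Suc (Suc n)) ** k n = h (Suc (Suc n)) ** coeff \<Phi> 2"
    using structure_relation[OF rec] by blast
  define Q where "Q = (\<lambda>n. Finite_Cartesian_Product.mat (1 / of_nat (Suc n)) *\<^sub>l mderiv (P (Suc n)))"
  let ?c = "\<lambda>n. real n / real (Suc n)"
  \<comment> \<open>The difference of the new coefficients is a multiple of \<gamma> - 2b: one b
    comes from the recurrence of Q, the other from its structure relation.\<close>
  have "invertible (?c (Suc n) *\<^sub>R (\<gamma> (Suc (Suc n)) - b (Suc (Suc n))) - ?c (Suc n) *\<^sub>R b (Suc (Suc n)))" for n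
  proof -
    have "?c (Suc n) *\<^sub>R (\<gamma> (Suc (Suc n)) - b (Suc (Suc n))) - ?c (Suc n) *\<^sub>R b (Suc (Suc n)) =
        ?c (Suc n) *\<^sub>R (\<gamma> (Suc (Suc n)) - real 2 *\<^sub>R b (Suc (Suc n)))"
      by (simp add: scaleR_diff_right[symmetric] scaleR_2 del: of_nat_Suc)
    then show ?thesis
      using scalar_invertible[of "?c (Suc n)"] invertible_gamma_minus_b[where b = b and n = n and s = 2, OF rec b] by simp
  qed
  then obtain w where w: "left_linear w" "is_MOP w (\<lambda>n. mderiv (Q (Suc n)))"
    using deriv_structure_imp_MOP[OF monic_rec_derivative[OF rec str, folded Q_def]] by blast
  have "invertible (Finite_Cartesian_Product.mat (1 / of_nat (Suc n)) :: 'm cmat)" for n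
    using scalar_invertible[of "1 / real (Suc n)" "Finite_Cartesian_Product.mat 1 :: 'm cmat"]
      mat_inverse_of_nat_mult[of "Suc n" "Finite_Cartesian_Product.mat 1 :: 'm cmat"]
    by (auto simp: invertible_def)
  then have "is_MOP v Q"
    unfolding Q_def by (rule is_MOP_lsmult[OF lv derivative_MOP])
  then show ?thesis
    using derivative_MOP_imp_pearson[OF lv _ w] unfolding P21_functional_def by blast
qed

end

theorem theorem3p14:
  fixes u :: "'m::finite mfunctional"
    and P :: "nat \<Rightarrow> 'm mpoly"
    and \<beta> \<gamma> :: "nat \<Rightarrow> 'm cmat"
  assumes "left_linear u"
    and "quasi_definite u"
    and "is_MOP u P"
    and "\<forall>n. monic_mpoly (P n)"
    and "\<forall>n. pCons 0 (P n) = P (n + 1) + \<beta> n *\<^sub>l P n + \<gamma> n *\<^sub>l pred_term P n"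
  defines "cond_i \<equiv> P21_functional u"
    and "cond_ii_for \<equiv> \<lambda>v :: 'm mfunctional.
           left_linear v \<and> quasi_definite v \<and> is_MOP v (\<lambda>n. mderiv (P (n + 1)))"
    and "cond_iii \<equiv> \<exists>a b :: nat \<Rightarrow> 'm cmat.
           (\<forall>n. P n = Finite_Cartesian_Product.mat (1 / of_nat (n + 1)) *\<^sub>l mderiv (P (n + 1))
                      + a n *\<^sub>l mderiv (P n) + b n *\<^sub>l mderiv (pred_term P n)) \<and>
           (\<forall>n\<ge>1. invertible (\<gamma> n - b n))"
  shows "(cond_i \<longleftrightarrow> (\<exists>v. cond_ii_for v)) \<and>
         ((\<exists>v. cond_ii_for v) \<longleftrightarrow> cond_iii) \<and>
         (\<forall>v. cond_ii_for v \<longrightarrow>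
            (\<exists>\<Phi> \<Psi>. pearson_pair u \<Phi> \<Psi> \<and> v = fun_mult u \<Phi>) \<and>
            quasi_definite v \<and> P21_functional v)"
proof -
  note lu = assms(1) and P = assms(3)
  have rec: "monic_rec P \<beta> \<gamma>"
    unfolding monic_rec_def
    using assms(4,5) is_MOPD(1)[OF P] by (auto simp: monic_mpoly_def)
  have iii_eq: "cond_iii \<longleftrightarrow> (\<exists>a b. deriv_structure P a b \<and> (\<forall>n\<ge>1. invertible (\<gamma> n - b n)))"
    unfolding cond_iii_def deriv_structure_def Suc_eq_plus1 ..
  have ii_eq: "cond_ii_for v \<longleftrightarrow> left_linear v \<and> is_MOP v (\<lambda>n. mderiv (P (Suc n)))" for v
    unfolding cond_ii_for_def Suc_eq_plus1 using is_MOP_imp_quasi_definite by blast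
  have pearson: "\<exists>\<Phi> \<Psi>. pearson_pair u \<Phi> \<Psi> \<and> v = fun_mult u \<Phi>" if "cond_ii_for v" for v
    using derivative_MOP_imp_pearson[OF lu P] that unfolding ii_eq by blast
  \<comment> \<open>A single Pearson pair gives (ii), (iii) and the additional claim on
    u\<Phi>.\<close>
  have from_pearson: "cond_ii_for (fun_mult u \<Phi>) \<and> cond_iii \<and> P21_functional (fun_mult u \<Phi>)"
    if "pearson_pair u \<Phi> \<Psi>" for \<Phi> \<Psi>
  proof -
    interpret pearson_MOP u P \<Phi> \<Psi>
      by unfold_locales (fact lu P that)+
    obtain a b where str: "deriv_structure P a b" "b 1 = 0"
      and b: "\<And>n. b (Suc (Suc n)) ** k n = h (Suc (Suc n)) ** coeff \<Phi> 2"
      using structure_relation[OF rec] by blast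
    have "invertible (\<gamma> n - b n)" if "n \<ge> 1" for n
    proof (cases "n = 1")
      case True
      \<comment> \<open>For n = 1 the choice b_1 = 0 leaves \<gamma>_1, a left factor of the
        non-singular \<open>h 1\<close>.\<close>
      have "\<gamma> 1 ** h 0 = h 1" using gamma_h[OF rec, of 0] by simp
      then have "invertible (\<gamma> 1)" using invertible_cancel_left is_MOPD(4)[OF P] by metis
      then show ?thesis using True str(2) by simp
    next
      case False
      then have "2 \<le> n" using that by simp
      then obtain j where "n = 2 + j" using le_Suc_ex by blast
      then have "n = Suc (Suc j)" by simp
      then show ?thesis using invertible_gamma_minus_b[where b = b and n = j and s = 1, OF rec b] by simp
    qed
    then have cond_iii unfolding iii_eq using str(1) by blast
    then show ?thesis
      using lv derivative_MOP P21_derivative[OF rec] unfolding ii_eq v_def by blast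
  qed
  have "\<exists>v. cond_ii_for v" if cond_iii
  proof -
    obtain a b where "deriv_structure P a b" "\<forall>n\<ge>1. invertible (\<gamma> n - b n)"
      using \<open>cond_iii\<close> unfolding iii_eq by blast
    then show ?thesis
      using deriv_structure_imp_MOP[OF rec, of a b] unfolding ii_eq by simp
  qed
  \<comment> \<open>Any v as in (ii) equals u\<Phi> for some Pearson pair, so what holds for u\<Phi>
    holds for v.\<close>
  moreover have "P21_functional v" if "cond_ii_for v" for v
    using pearson[OF that] from_pearson by blast
  moreover have "quasi_definite v" if "cond_ii_for v" for v
    using that unfolding cond_ii_for_def by blast
  ultimately show ?thesis
    using pearson from_pearson unfolding cond_i_def P21_functional_def[of u] by blast
qed

end
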